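(* Let $n \ge 2$ be an integer, $a \in \mathbb{Z}$, and suppose $f(x) = (x^2+1)^n - a x^n$ is irreducible over $\mathbb{Q}$. Let $\theta$ be a root of $f$, $K = \mathbb{Q}(\theta)$, and $\mathbb{Z}_K$ the ring of integers of $K$. Let $p$ be a prime dividing $\Delta(f)$. Then $p$ does not divide $[\mathbb{Z}_K : \mathbb{Z}[\theta]]$ if and only if the following condition (the one among (i)–(iv) applicable to $p$) holds: (i) if $p \mid a$: $p^2 \nmid a$; (ii) if $p \nmid a$ and $p \mid n$: $p^2 \nmid (a^{p^j} - a)$, where $p^j$ is the highest power of $p$ dividing $n$; (iii) if $p \nmid an$ and $n$ is odd: $p^2 \nmid \Delta(f)$; (iv) if $p \nmid an$ and $n$ is even: $p^2 \nmid (2^n - a)$.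
   Context: $\Delta(f)$ is the discriminant of $f$; it equals $(-1)^{\binom{2n}{2}} n^{2n} a^{2n-2}(2^n-a)(2^n-(-1)^n a)$. $[\mathbb{Z}_K:\mathbb{Z}[\theta]]$ is the (finite) index of the subring $\mathbb{Z}[\theta]$ in $\mathbb{Z}_K$, called the index of $f$. *)

theory Defs
  imports Complex_Main "HOL-Computational_Algebra.Polynomial" "Subresultants.Resultant_Prelim"
begin

definition poly_disc :: "int poly \<Rightarrow> int" where
  "poly_disc f = (-1) ^ (degree f * (degree f - 1) div 2) *
                 (resultant f (pderiv f) div lead_coeff f)"

definition fpoly :: "nat \<Rightarrow> int \<Rightarrow> int poly" where
  "fpoly n a = [:1, 0, 1:] ^ n - monom a n"

definition num_field :: "complex \<Rightarrow> complex set" where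
  "num_field \<theta> = {poly (map_poly of_rat g) \<theta> | g :: rat poly. True}"

definition ring_of_integers :: "complex \<Rightarrow> complex set" where
  "ring_of_integers \<theta> = {x \<in> num_field \<theta>. algebraic_int x}"

definition Z_adjoin :: "complex \<Rightarrow> complex set" where
  "Z_adjoin \<theta> = {poly (map_poly of_int g) \<theta> | g :: int poly. True}"

definition order_index :: "complex \<Rightarrow> nat" where
  "order_index \<theta> = card (ring_of_integers \<theta> //
     {(x, y). x \<in> ring_of_integers \<theta> \<and> y \<in> ring_of_integers \<theta> \<and> x - y \<in> Z_adjoin \<theta>})"

end

(*
  The index [Z_K : Z[theta]] is finite, since f'(theta) Z_K lies in Z[theta]; so p divides it iff
  some y in Z_K outside Z[theta] has p y in Z[theta]. By Dedekind's criterion this happens iff f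
  lies in the square of an ideal (p, pi) of Z[X] with pi irreducible modulo p.
    (i)   p | a: f = (x^2+1)^n modulo p, so pi divides x^2+1, and f is in (p, pi)^2 iff a x^n is.
    (ii)  p | n, n = q m with q = p^j: with w = (x^2+1)^m - a x^m one has
          f = w^q + p w S + (a^q - a) x^n, so pi divides w, and f is in (p, pi)^2 iff
          (a^q - a) x^n is.
    (iii), (iv) p does not divide a n: since x f' = n (f - (x^2+1)^(n-1) (1-x^2)), a double
          root of f modulo p is 1 or -1, and f is in (p, x - e)^2 iff p^2 | f(e), for e = 1, -1.
  The same identity for x f', multiplied over the roots of f, gives the discriminant.
*)
theory Submission
  imports Defs
    "HOL-Algebra.Sylow"
    "HOL-Computational_Algebra.Polynomial_Factorial"
    "HOL-Computational_Algebra.Field_as_Ring"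
    "Jordan_Normal_Form.Char_Poly"
    "Subresultants.Subresultant"
begin

section \<open>Algebraic integers\<close>

text \<open>Since \<open>card\<close> of an infinite set is 0, \<open>order_index\<close> carries
  information about \<open>p\<close> only once the quotient is known to be finite; hence the
  conductor bound comes before Dedekind's criterion. Arithmetic modulo \<open>p\<close> is done in
  Z[X] with the ideals \<open>(p, d)\<close>, \<open>d\<close> monic, so that membership in
  \<open>(p, pi)^2\<close>, which depends on coefficients modulo \<open>p^2\<close>, can be treated
  in the same ring. In cases (i) and (ii) \<open>f\<close> differs from an element of
  \<open>(p, pi)^2\<close> by a term \<open>p c x^n\<close>. If that term is in the square, removing
  one \<open>p\<close> leaves \<open>c x^n\<close> in \<open>(p, pi)\<close>; as
  \<open>f(0) = 1\<close> makes \<open>x\<close> a unit modulo \<open>f\<close>, this forces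
  \<open>p\<close> to divide \<open>c\<close>. So the coefficients \<open>a\<close> and
  \<open>a^q - a\<close> alone decide. In cases (iii) and (iv) the test is the same:
  \<open>p^2\<close> divides \<open>f(1) = 2^n - a\<close> or \<open>f(-1) = 2^n - (-1)^n a\<close>.
  For odd \<open>n\<close> the prime divides at most one of the two, so the test can be read off
  from their product in the discriminant; for even \<open>n\<close> they are equal and the product
  is a square, so a single factor has to be tested.\<close>

global_interpretation int_module: Modules.module "\<lambda>(n::int) (x::complex). of_int n * x"
  by unfold_locales (auto simp: algebra_simps)

lemma span_mult_closed:
  assumes "\<And>b. b \<in> B \<Longrightarrow> y * b \<in> int_module.span B" "x \<in> int_module.span B"
  shows "y * x \<in> int_module.span B"
proof -
  have "int_module.subspace {x. y * x \<in> int_module.span B}"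
    unfolding int_module.subspace_def
    by (auto simp: distrib_left mult.left_commute[of y] int_module.span_zero
        intro: int_module.span_add int_module.span_scale)
  from int_module.span_induct[OF assms(2) this] assms(1) show ?thesis by auto
qed

text \<open>Determinant trick: multiplication by \<open>y\<close> acts on the generators through an
  integer matrix, and the vector of generators, nonzero because of \<open>b0\<close>, is an
  eigenvector for \<open>y\<close>. So \<open>y\<close> is a root of a characteristic polynomial
  that is monic over the integers.\<close>

lemma algebraic_int_of_span:
  assumes fin: "finite B" and b0: "b0 \<in> B" "b0 \<noteq> 0"
    and cl: "\<And>b. b \<in> B \<Longrightarrow> y * b \<in> int_module.span B"
  shows "algebraic_int (y::complex)"
proof -
  obtain v where v: "bij_betw v {..<card B} B"
    using fin by (metis ex_bij_betw_nat_finite atLeast0LessThan)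
  define m where "m = card B"
  have "\<forall>b\<in>B. \<exists>c. y * b = (\<Sum>x\<in>B. of_int (c x) * x)"
    using cl unfolding int_module.span_finite[OF fin] by auto
  then obtain c where c: "\<And>b. b \<in> B \<Longrightarrow> y * b = (\<Sum>x\<in>B. of_int (c b x) * x)"
    by metis
  define M :: "int mat" where "M = mat m m (\<lambda>(i,j). c (v i) (v j))"
  have M: "M \<in> carrier_mat m m" by (simp add: M_def)
  define A :: "complex mat" where "A = map_mat of_int M"
  have A: "A \<in> carrier_mat m m" by (simp add: A_def M_def)
  have "A *\<^sub>v vec m v = y \<cdot>\<^sub>v vec m v"
  proof (rule eq_vecI)
    fix i assume "i < dim_vec (y \<cdot>\<^sub>v vec m v)"
    then have i: "i < m" by simp
    have "(\<Sum>j<m. of_int (c (v i) (v j)) * v j) = (\<Sum>x\<in>B. of_int (c (v i) x) * x)"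
      by (rule sum.reindex_bij_betw[OF v[folded m_def]])
    also have "\<dots> = y * v i"
      using c[of "v i"] bij_betwE[OF v] i by (simp add: m_def)
    finally show "(A *\<^sub>v vec m v) $ i = (y \<cdot>\<^sub>v vec m v) $ i"
      using i M by (simp add: A_def M_def scalar_prod_def row_def atLeast0LessThan)
  qed (use A in auto)
  moreover have "b0 \<in> v ` {..<m}"
    using bij_betw_imp_surj_on[OF v] b0 by (simp add: m_def)
  then obtain k where "k < m" "v k = b0" by auto
  then have "vec m v \<noteq> 0\<^sub>v m"
    using b0 by (metis index_vec index_zero_vec(1))
  ultimately have "eigenvalue A y"
    using A unfolding eigenvalue_def eigenvector_def by (intro exI[of _ "vec m v"]) auto
  then have "poly (char_poly A) y = 0"
    using eigenvalue_root_char_poly[OF A] by simp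
  moreover have "char_poly A = map_poly of_int (char_poly M)"
    unfolding A_def by (rule of_int_hom.char_poly_hom[OF M])
  moreover have "lead_coeff (char_poly M) = 1"
    using degree_monic_char_poly[OF M] by simp
  ultimately show ?thesis
    unfolding algebraic_int_altdef_ipoly by auto
qed

definition ipoly :: "int poly \<Rightarrow> complex \<Rightarrow> complex" where
  "ipoly g x = poly (map_poly of_int g) x"

lemma ipoly_simps [simp]:
  "ipoly 0 x = 0" "ipoly 1 x = 1" "ipoly (g + h) x = ipoly g x + ipoly h x"
  "ipoly (g - h) x = ipoly g x - ipoly h x" "ipoly (- g) x = - ipoly g x"
  "ipoly (g * h) x = ipoly g x * ipoly h x" "ipoly (g ^ k) x = ipoly g x ^ k"
  "ipoly (pCons c g) x = of_int c + x * ipoly g x"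
  "ipoly (monom c k) x = of_int c * x ^ k" "ipoly (smult c g) x = of_int c * ipoly g x"
  by (simp_all add: ipoly_def hom_distribs poly_monom)

lemma ipoly_sum: "ipoly (\<Sum>i\<in>A. g i) x = (\<Sum>i\<in>A. ipoly (g i) x)"
  by (induction A rule: infinite_finite_induct) simp_all

lemma ipoly_altdef: "ipoly g x = (\<Sum>i\<le>degree g. of_int (coeff g i) * x ^ i)"
  by (simp add: ipoly_def poly_altdef)

lemma monic_degree_pos:
  assumes "lead_coeff P = 1" "ipoly P x = 0"
  shows "degree P > 0"
proof (rule ccontr)
  assume "\<not> degree P > 0"
  then obtain c where "P = [:c:]" by (auto elim: degree_eq_zeroE)
  with assms show False by simp
qed

text \<open>The monomials \<open>\<alpha>^i y^j\<close> below the degrees of the two monic equations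
  span a module stable under \<alpha> and \<open>y\<close>, since these equations reduce
  \<open>\<alpha>^a\<close> and \<open>y^b\<close>. Coefficients from Z[\<alpha>] in the equation of
  \<open>y\<close> make the lemma cover sums, products and roots of monic polynomials over
  Z[\<alpha>] at once.\<close>

lemma algebraic_int_extend:
  assumes \<alpha>: "algebraic_int \<alpha>" and b: "b > 0"
    and y: "y ^ b = (\<Sum>j<b. ipoly (g j) \<alpha> * y ^ j)"
  shows "algebraic_int (\<alpha> + y)" "algebraic_int (\<alpha> * y)" "algebraic_int y"
proof -
  obtain P where P: "ipoly P \<alpha> = 0" "lead_coeff P = 1"
    using \<alpha> unfolding algebraic_int_altdef_ipoly ipoly_def by auto
  define a where "a = degree P"
  have a: "a > 0" using monic_degree_pos[OF P(2,1)] by (simp add: a_def)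
  define B where "B = (\<lambda>(i,j). \<alpha> ^ i * y ^ j) ` ({..<a} \<times> {..<b})"
  let ?S = "int_module.span B"
  have fin: "finite B" by (simp add: B_def)
  have one: "1 \<in> B" unfolding B_def using a b by force
  have base: "\<alpha> ^ i * y ^ j \<in> ?S" if "i < a" "j < b" for i j
    using that by (intro int_module.span_base) (auto simp: B_def)
  have "(\<Sum>i\<le>a. of_int (coeff P i) * \<alpha> ^ i) = 0"
    using P(1) by (simp add: ipoly_altdef a_def)
  then have pa: "\<alpha> ^ a = (\<Sum>i<a. of_int (- coeff P i) * \<alpha> ^ i)"
    using P(2) by (simp add: a_def lessThan_Suc_atMost[symmetric] sum_negf
        eq_neg_iff_add_eq_0 add.commute del: lessThan_Suc_atMost)
  have \<alpha>B: "\<alpha> * z \<in> ?S" if "z \<in> B" for z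
  proof -
    from that obtain i j where ij: "i < a" "j < b" "z = \<alpha> ^ i * y ^ j" by (auto simp: B_def)
    show ?thesis
    proof (cases "Suc i < a")
      case True
      with base[OF this ij(2)] ij(3) show ?thesis by (simp add: mult_ac)
    next
      case False
      with ij have "\<alpha> * z = \<alpha> ^ a * y ^ j"
        by (metis Suc_lessI mult.assoc power_Suc)
      also have "\<dots> = (\<Sum>i<a. of_int (- coeff P i) * (\<alpha> ^ i * y ^ j))"
        unfolding pa sum_distrib_right by (simp only: mult.assoc)
      also have "\<dots> \<in> ?S"
        using ij(2) by (intro int_module.span_sum int_module.span_scale base) auto
      finally show ?thesis .
    qed
  qed
  have \<alpha>S: "\<alpha> * z \<in> ?S" if "z \<in> ?S" for z
    using span_mult_closed[OF \<alpha>B that] .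
  have gS: "ipoly h \<alpha> * z \<in> ?S" if "z \<in> ?S" for z h
    by (induction h)
      (auto simp: int_module.span_zero ring_distribs mult.assoc
        intro!: int_module.span_add int_module.span_scale \<alpha>S that)
  have yB: "y * z \<in> ?S" if "z \<in> B" for z
  proof -
    from that obtain i j where ij: "i < a" "j < b" "z = \<alpha> ^ i * y ^ j" by (auto simp: B_def)
    show ?thesis
    proof (cases "Suc j < b")
      case True
      with base[OF ij(1) this] ij(3) show ?thesis by (simp add: mult_ac)
    next
      case False
      with ij have "y * z = \<alpha> ^ i * y ^ b"
        by (metis Suc_lessI mult.left_commute power_Suc)
      also have "\<dots> = (\<Sum>j<b. ipoly (g j) \<alpha> * (\<alpha> ^ i * y ^ j))"
        unfolding y sum_distrib_left by (simp only: mult.left_commute)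
      also have "\<dots> \<in> ?S"
        using ij(1) by (intro int_module.span_sum gS base) auto
      finally show ?thesis .
    qed
  qed
  have yS: "y * z \<in> ?S" if "z \<in> ?S" for z
    using span_mult_closed[OF yB that] .
  note * = algebraic_int_of_span[OF fin one one_neq_zero]
  show "algebraic_int y" by (rule *) (rule yB)
  show "algebraic_int (\<alpha> + y)"
    by (rule *) (auto simp: ring_distribs intro!: int_module.span_add \<alpha>B yB)
  show "algebraic_int (\<alpha> * y)"
    by (rule *) (auto simp: mult.assoc intro!: \<alpha>S yB)
qed

lemma algebraic_int_add_mult:
  assumes "algebraic_int x" "algebraic_int (y :: complex)"
  shows "algebraic_int (x + y)" "algebraic_int (x * y)"
proof -
  obtain P where P: "ipoly P y = 0" "lead_coeff P = 1"
    using assms(2) unfolding algebraic_int_altdef_ipoly ipoly_def by auto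
  have "(\<Sum>i\<le>degree P. of_int (coeff P i) * y ^ i) = 0"
    using P(1) by (simp add: ipoly_altdef)
  then have "y ^ degree P = (\<Sum>i<degree P. ipoly [:- coeff P i:] x * y ^ i)"
    using P(2) by (simp add: lessThan_Suc_atMost[symmetric] sum_negf
        eq_neg_iff_add_eq_0 add.commute del: lessThan_Suc_atMost)
  from algebraic_int_extend[OF assms(1) monic_degree_pos[OF P(2,1)] this]
  show "algebraic_int (x + y)" "algebraic_int (x * y)" by auto
qed

lemma algebraic_int_ipoly: "algebraic_int x \<Longrightarrow> algebraic_int (ipoly g x)"
  by (induction g) (auto intro!: algebraic_int_add_mult)

text \<open>Serves the witness \<open>y\<close> of \<open>prime_dvd_index\<close>, whose integrality
  is known only through a monic quadratic over Z[\<theta>].\<close>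

lemma algebraic_int_quadratic:
  assumes "algebraic_int \<alpha>" "y\<^sup>2 + ipoly t \<alpha> * y + ipoly u \<alpha> = 0"
  shows "algebraic_int y"
proof (rule algebraic_int_extend(3)[OF assms(1)])
  show "y ^ 2 = (\<Sum>j<2. ipoly (if j = 0 then - u else - t) \<alpha> * y ^ j)"
    using assms(2) by (simp add: numeral_2_eq_2 algebra_simps eq_neg_iff_add_eq_0)
qed simp

lemma algebraic_int_sum:
  "(\<And>i. i \<in> A \<Longrightarrow> algebraic_int (f i :: complex)) \<Longrightarrow> algebraic_int (\<Sum>i\<in>A. f i)"
  by (induction A rule: infinite_finite_induct) (auto intro: algebraic_int_add_mult)

section \<open>Finiteness of the index\<close>

lemma monic_division:
  fixes f g :: "int poly"
  assumes "lead_coeff f = 1"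
  obtains q r where "g = q * f + r" "r = 0 \<or> degree r < degree f"
proof -
  have f0: "f \<noteq> 0" using assms by auto
  obtain q r where qr: "pseudo_divmod g f = (q, r)" by force
  from pseudo_divmod[OF f0 qr] assms have "g = q * f + r" "r = 0 \<or> degree r < degree f"
    by (simp_all add: mult.commute)
  then show ?thesis by (rule that)
qed

lemma clear_denominators:
  fixes G :: "rat poly"
  shows "\<exists>d h. d > 0 \<and> smult (of_int d) G = map_poly of_int h"
proof (induction G)
  case 0
  show ?case by (rule exI[of _ 1], rule exI[of _ 0]) simp
next
  case (pCons c G)
  then obtain d h where dh: "d > 0" "smult (of_int d) G = map_poly of_int h" by auto
  obtain a b where ab: "c = of_int a / of_int b" "b > 0"
    by (metis quotient_of_div quotient_of_denom_pos surj_pair)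
  have "smult (of_int (d * b)) (pCons c G)
      = map_poly of_int (pCons (d * a) (smult b h))"
  proof -
    have "smult (of_int (d * b)) (pCons c G)
        = pCons (of_int (d * b) * c) (smult (of_int b) (smult (of_int d) G))"
      by (simp add: mult.commute)
    also have "of_int (d * b) * c = of_int (d * a)" using ab by simp
    also have "smult (of_int b) (smult (of_int d) G) = map_poly of_int (smult b h)"
      unfolding dh(2) by (simp add: hom_distribs)
    finally show ?thesis by (simp add: hom_distribs)
  qed
  with dh ab show ?case by (intro exI[of _ "d * b"]) auto
qed

interpretation of_rat_poly_hom: map_poly_comm_ring_hom "of_rat :: rat \<Rightarrow> complex"
  by unfold_locales

section \<open>Polynomials in \<theta>, the order Z[\<theta>] and the ring of integers\<close>

locale monic_irreducible =
  fixes f :: "int poly" and \<theta> :: complex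
  assumes monic: "lead_coeff f = 1"
    and irr: "irreducible (map_poly of_int f :: rat poly)"
    and root: "ipoly f \<theta> = 0"
begin

definition rpoly :: "rat poly \<Rightarrow> complex \<Rightarrow> complex" where
  "rpoly g x = poly (map_poly of_rat g) x"

lemma rpoly_simps [simp]:
  "rpoly 0 x = 0" "rpoly 1 x = 1" "rpoly (g + h) x = rpoly g x + rpoly h x"
  "rpoly (g - h) x = rpoly g x - rpoly h x" "rpoly (- g) x = - rpoly g x"
  "rpoly (g * h) x = rpoly g x * rpoly h x"
  "rpoly (pCons c g) x = of_rat c + x * rpoly g x"
  "rpoly (smult c g) x = of_rat c * rpoly g x"
  by (simp_all add: rpoly_def hom_distribs of_rat_poly_hom.hom_mult of_rat_poly_hom.hom_minus
      of_rat_poly_hom.hom_uminus)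

lemma rpoly_of_int: "rpoly (map_poly of_int g) x = ipoly g x"
  by (induction g) (simp_all add: hom_distribs)

lemma coprime_bezout:
  assumes "\<not> map_poly of_int f dvd (G :: rat poly)"
  obtains a b where "a * map_poly of_int f + b * G = 1"
proof -
  have "coprime (map_poly of_int f) G"
    by (rule prime_elem_imp_coprime[OF irreducible_imp_prime_elem[OF irr] assms])
  then show ?thesis
    using that bezout_coefficients_fst_snd[of "map_poly of_int f" G] by auto
qed

lemma rpoly_zero_imp_dvd:
  assumes "rpoly G \<theta> = 0"
  shows "map_poly of_int f dvd G"
proof (rule ccontr)
  assume "\<not> ?thesis"
  then obtain a b where "a * map_poly of_int f + b * G = 1" by (rule coprime_bezout)
  from arg_cong[OF this, of "\<lambda>p. rpoly p \<theta>"] assms root show False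
    by (simp add: rpoly_of_int)
qed

lemma ipoly_zero_small:
  assumes "ipoly g \<theta> = 0" "degree g < degree f"
  shows "g = 0"
proof (rule ccontr)
  assume "g \<noteq> 0"
  moreover have "map_poly of_int f dvd (map_poly of_int g :: rat poly)"
    using rpoly_zero_imp_dvd[of "map_poly of_int g"] assms by (simp add: rpoly_of_int)
  ultimately have "degree f \<le> degree g"
    using dvd_imp_degree_le[of "map_poly of_int f" "map_poly of_int g :: rat poly"] by simp
  with assms show False by simp
qed

lemma degree_pos: "degree f > 0"
  using monic_degree_pos[OF monic root] .

text \<open>Division by the monic \<open>f\<close> stays in Z[X], and a remainder of degree below
  \<open>f\<close> that vanishes at \<theta> is zero; so the divisibility holds over the integers
  and not only over the rationals.\<close>

lemma ipoly_zero_imp_dvd: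
  assumes "ipoly g \<theta> = 0"
  shows "f dvd g"
proof -
  obtain q r where qr: "g = q * f + r" "r = 0 \<or> degree r < degree f"
    using monic_division[OF monic] by blast
  have "ipoly r \<theta> = 0" using qr(1) assms root by simp
  with qr show ?thesis using ipoly_zero_small[of r] by auto
qed

abbreviation "O_K \<equiv> ring_of_integers \<theta>"
abbreviation "R \<equiv> Z_adjoin \<theta>"

lemma R_iff: "x \<in> R \<longleftrightarrow> (\<exists>g. x = ipoly g \<theta>)"
  by (auto simp: Z_adjoin_def ipoly_def)

lemma O_iff: "x \<in> O_K \<longleftrightarrow> (\<exists>g. x = rpoly g \<theta>) \<and> algebraic_int x"
  by (auto simp: ring_of_integers_def num_field_def rpoly_def)

lemma algebraic_int_\<theta>: "algebraic_int \<theta>"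
  unfolding algebraic_int_altdef_ipoly using root monic by (auto simp: ipoly_def)

lemma R_subset_O: "R \<subseteq> O_K"
  unfolding O_iff R_iff subset_iff
  by (metis algebraic_int_\<theta> algebraic_int_ipoly rpoly_of_int)

lemma R_closed:
  "x \<in> R \<Longrightarrow> y \<in> R \<Longrightarrow> x + y \<in> R" "x \<in> R \<Longrightarrow> y \<in> R \<Longrightarrow> x * y \<in> R"
  "x \<in> R \<Longrightarrow> y \<in> R \<Longrightarrow> x - y \<in> R" "x \<in> R \<Longrightarrow> - x \<in> R" "0 \<in> R" "of_int k \<in> R"
  unfolding R_iff
proof safe
  fix g h
  show "\<exists>k. ipoly g \<theta> + ipoly h \<theta> = ipoly k \<theta>" by (rule exI[of _ "g + h"]) simp
  show "\<exists>k. ipoly g \<theta> * ipoly h \<theta> = ipoly k \<theta>" by (rule exI[of _ "g * h"]) simp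
  show "\<exists>k. ipoly g \<theta> - ipoly h \<theta> = ipoly k \<theta>" by (rule exI[of _ "g - h"]) simp
  show "\<exists>k. - ipoly g \<theta> = ipoly k \<theta>" by (rule exI[of _ "- g"]) simp
  show "\<exists>k. 0 = ipoly k \<theta>" by (rule exI[of _ 0]) simp
  show "\<exists>g. of_int k = ipoly g \<theta>" by (rule exI[of _ "[:k:]"]) simp
qed

lemma O_closed:
  assumes "x \<in> O_K" "y \<in> O_K"
  shows "x + y \<in> O_K" "x * y \<in> O_K" "- x \<in> O_K" "x - y \<in> O_K"
proof -
  obtain g h where gh: "x = rpoly g \<theta>" "y = rpoly h \<theta>" "algebraic_int x" "algebraic_int y"
    using assms unfolding O_iff by auto
  show "x + y \<in> O_K" unfolding O_iff
    using gh algebraic_int_add_mult by (intro conjI exI[of _ "g + h"]) auto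
  show "x * y \<in> O_K" unfolding O_iff
    using gh algebraic_int_add_mult by (intro conjI exI[of _ "g * h"]) auto
  show "- x \<in> O_K" unfolding O_iff
    using gh by (intro conjI exI[of _ "- g"]) auto
  show "x - y \<in> O_K" unfolding O_iff
    using gh algebraic_int_add_mult(1)[of x "- y"] by (intro conjI exI[of _ "g - h"]) auto
qed

text \<open>The equation \<open>P(G(\<theta>)) = 0\<close> means that \<open>f\<close> divides the
  composition of \<open>P\<close> and \<open>G\<close>, a statement in which all roots of
  \<open>f\<close> are on an equal footing. The same monic \<open>P\<close> thus kills
  \<open>G(\<alpha>)\<close>.\<close>

lemma rpoly_algebraic_int_conjugate:
  assumes "algebraic_int (rpoly G \<theta>)" "ipoly f \<alpha> = 0"
  shows "algebraic_int (rpoly G \<alpha>)"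
proof -
  obtain P where P: "ipoly P (rpoly G \<theta>) = 0" "lead_coeff P = 1"
    using assms(1) unfolding algebraic_int_altdef_ipoly ipoly_def by auto
  have *: "rpoly (pcompose (map_poly of_int P) G) x = ipoly P (rpoly G x)" for x
  proof (induction P)
    case (pCons c P)
    have "rpoly (of_int c) x = of_int c" unfolding of_int_poly rpoly_simps(1,7) by simp
    with pCons show ?case by (simp add: hom_distribs pcompose_pCons)
  qed simp
  have "map_poly of_int f dvd pcompose (map_poly of_int P) G"
    by (rule rpoly_zero_imp_dvd) (simp add: * P)
  then obtain Q where "pcompose (map_poly of_int P) G = map_poly of_int f * Q" ..
  from arg_cong[OF this, of "\<lambda>p. rpoly p \<alpha>"] have "ipoly P (rpoly G \<alpha>) = 0"
    by (simp add: * rpoly_of_int assms)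
  with P(2) show ?thesis unfolding algebraic_int_altdef_ipoly ipoly_def by auto
qed

text \<open>Irreducibility and degree make \<open>f\<close> and \<open>f'\<close> coprime over the
  rationals; \<open>d\<close> clears the denominators of the cofactor. It yields both the simplicity
  of the roots and an integer multiple of \<open>f'(\<theta>)\<close>.\<close>

lemma pderiv_bezout:
  obtains d v where "d > 0" "\<And>x. ipoly f x = 0 \<Longrightarrow> ipoly v x * ipoly (pderiv f) x = of_int d"
proof -
  have pd: "pderiv f \<noteq> 0" using degree_pos by (simp add: pderiv_eq_0_iff)
  have "\<not> map_poly of_int f dvd (map_poly of_int (pderiv f) :: rat poly)"
  proof
    assume "map_poly of_int f dvd (map_poly of_int (pderiv f) :: rat poly)"
    from dvd_imp_degree_le[OF this] pd have "degree f \<le> degree (pderiv f)" by simp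
    then show False using degree_pos by (simp add: degree_pderiv)
  qed
  then obtain a b :: "rat poly"
    where ab: "a * map_poly of_int f + b * map_poly of_int (pderiv f) = 1"
    by (rule coprime_bezout)
  obtain d v where d: "d > 0" "smult (of_int d) b = map_poly of_int v"
    using clear_denominators by blast
  show thesis
  proof (rule that[OF d(1)])
    fix x assume x: "ipoly f x = 0"
    have "rpoly b x * ipoly (pderiv f) x = 1"
      using arg_cong[OF ab, of "\<lambda>p. rpoly p x"] x by (simp add: rpoly_of_int)
    moreover have "of_int d * rpoly b x = ipoly v x"
      using arg_cong[OF d(2), of "\<lambda>p. rpoly p x"] by (simp add: rpoly_of_int)
    ultimately show "ipoly v x * ipoly (pderiv f) x = of_int d"
      by (metis mult.assoc mult.right_neutral)
  qed
qed

text \<open>The polynomial of degree less than \<open>degree f\<close> congruent to \<open>G f'\<close> modulo \<open>f\<close> is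
  \<open>\<Sum> G(\<alpha>) f/(X - \<alpha>)\<close>, summed over the roots \<open>\<alpha>\<close> of \<open>f\<close>, so its rational coefficients are
  algebraic integers.\<close>

lemma mult_pderiv_in_R:
  assumes "x \<in> O_K"
  shows "x * ipoly (pderiv f) \<theta> \<in> R"
proof -
  obtain G where G: "x = rpoly G \<theta>" "algebraic_int x" using assms unfolding O_iff by auto
  define F :: "rat poly" where "F = map_poly of_int f"
  define h where "h = (G * map_poly of_int (pderiv f)) mod F"
  define C :: "complex poly" where "C = map_poly of_int f"
  have F0: "degree F > 0" using degree_pos by (simp add: F_def)
  have h: "G * map_poly of_int (pderiv f) = (G * map_poly of_int (pderiv f)) div F * F + h"
    by (simp add: h_def)
  have hroot: "rpoly h \<alpha> = rpoly G \<alpha> * ipoly (pderiv f) \<alpha>" if "ipoly f \<alpha> = 0" for \<alpha>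
    using arg_cong[OF h, of "\<lambda>p. rpoly p \<alpha>"] that by (simp add: rpoly_of_int F_def)
  have degh: "degree h < degree f"
    using degree_mod_less[of F "G * map_poly of_int (pderiv f)"] F0 degree_pos
    by (cases "F = 0") (auto simp: h_def F_def)
  define A where "A = {z. ipoly f z = 0}"
  have A: "A = {z. poly C z = 0}" by (simp add: A_def C_def ipoly_def)
  obtain d v where dv: "(d::int) > 0"
    "\<And>x. ipoly f x = 0 \<Longrightarrow> ipoly v x * ipoly (pderiv f) x = of_int d"
    using pderiv_bezout by blast
  have pdC: "poly (pderiv C) z = ipoly (pderiv f) z" for z
    by (simp add: C_def ipoly_def of_int_hom.map_poly_pderiv)
  have "rsquarefree C"
    unfolding rsquarefree_roots pdC using dv by (fastforce simp: C_def ipoly_def)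
  moreover have "lead_coeff C = 1" using monic by (simp add: C_def)
  ultimately have C: "C = (\<Prod>z\<in>A. [:- z, 1:])"
    using complex_poly_decompose_rsquarefree[of C] by (simp add: A)
  have C0: "C \<noteq> 0" using \<open>lead_coeff C = 1\<close> by auto
  have finA: "finite A" using poly_roots_finite[OF C0] by (simp add: A)
  have cardA: "card A = degree f"
  proof -
    have "degree C = (\<Sum>z\<in>A. degree [:- z, 1::complex:])"
      unfolding C by (rule degree_prod_eq_sum_degree) auto
    then show ?thesis by (simp add: C_def)
  qed
  define L where "L \<alpha> = (\<Prod>z\<in>A-{\<alpha>}. [:- z, 1:])" for \<alpha>
  have degL: "degree (L \<alpha>) = card A - 1" if "\<alpha> \<in> A" for \<alpha>
    unfolding L_def using that finA by (subst degree_prod_eq_sum_degree) auto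
  have L0: "poly (L \<alpha>) \<beta> = 0" if "\<beta> \<in> A" "\<beta> \<noteq> \<alpha>" for \<alpha> \<beta>
    unfolding L_def using that finA by (auto simp: poly_prod)
  have pdL: "ipoly (pderiv f) \<alpha> = poly (L \<alpha>) \<alpha>" if "\<alpha> \<in> A" for \<alpha>
  proof -
    have "pderiv C = (\<Sum>z\<in>A. L z)"
      unfolding C pderiv_prod L_def by (simp add: pderiv_pCons)
    then have "ipoly (pderiv f) \<alpha> = (\<Sum>z\<in>A. poly (L z) \<alpha>)"
      by (simp flip: pdC add: poly_sum)
    also have "\<dots> = (\<Sum>z\<in>A. if z = \<alpha> then poly (L \<alpha>) \<alpha> else 0)"
      using that L0 by (intro sum.cong) auto
    finally show ?thesis using that finA by simp
  qed
  define H where "H = (\<Sum>\<alpha>\<in>A. smult (rpoly G \<alpha>) (L \<alpha>))"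
  \<comment> \<open>Lagrange interpolation: both sides have degree below the number of roots, and at
    a root \<beta> both equal \<open>G(\<beta>) f'(\<beta>)\<close>, because
    \<open>L \<beta>\<close> takes the value \<open>f'(\<beta>)\<close> at \<beta> and every other
    \<open>L z\<close> vanishes there.\<close>
  have "map_poly of_rat h = H"
  proof (rule poly_eqI_degree)
    fix \<beta> assume \<beta>: "\<beta> \<in> A"
    have "poly H \<beta> = (\<Sum>z\<in>A. if z = \<beta> then rpoly G \<beta> * poly (L \<beta>) \<beta> else 0)"
      unfolding H_def poly_sum using \<beta> L0 by (intro sum.cong) auto
    also have "\<dots> = rpoly G \<beta> * ipoly (pderiv f) \<beta>"
      using \<beta> finA pdL by simp
    finally show "poly (map_poly of_rat h) \<beta> = poly H \<beta>"
      using hroot[of \<beta>] \<beta> by (simp add: A_def rpoly_def)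
  next
    show "degree (map_poly of_rat h :: complex poly) < card A"
      using degh by (simp add: cardA)
    have "degree H \<le> card A - 1"
      unfolding H_def by (intro degree_sum_le finA order.trans[OF degree_smult_le]) (simp add: degL)
    then show "degree H < card A" using cardA degree_pos by simp
  qed
  have prod_alg: "algebraic_int (coeff (\<Prod>z\<in>S. [:- z, 1:]) i)"
    if "finite S" "S \<subseteq> A" for S i
    using that
  proof (induction S arbitrary: i rule: finite_induct)
    case empty
    then show ?case by (simp add: coeff_1)
  next
    case (insert z S)
    have "algebraic_int z"
      using insert.prems monic unfolding A_def ipoly_def algebraic_int_altdef_ipoly by auto
    then have "algebraic_int (coeff [:- z, 1:] k)" for k
      by (auto simp: coeff_pCons split: nat.splits)
    moreover have "algebraic_int (coeff (\<Prod>z\<in>S. [:- z, 1:]) k)" for k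
      using insert by simp
    ultimately show ?case
      unfolding prod.insert[OF insert.hyps] coeff_mult
      by (intro algebraic_int_sum algebraic_int_add_mult)
  qed
  have "algebraic_int (coeff H i)" for i
    unfolding H_def coeff_sum coeff_smult L_def
    using prod_alg finA rpoly_algebraic_int_conjugate[of G] G
    by (intro algebraic_int_sum algebraic_int_add_mult) (auto simp: A_def)
  then have "algebraic_int (of_rat (coeff h i) :: complex)" for i
    unfolding \<open>map_poly of_rat h = H\<close>[symmetric] by simp
  then have "(of_rat (coeff h i) :: complex) \<in> \<int>" for i
    by (rule rational_algebraic_int_is_int) auto
  then have int: "of_int (floor (coeff h i)) = coeff h i" for i
    by (metis Ints_cases floor_of_int of_rat_eq_iff of_rat_of_int_eq)
  define h0 where "h0 = map_poly floor h"
  have "map_poly of_int h0 = h"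
    by (rule poly_eqI) (simp add: h0_def coeff_map_poly int)
  then have "x * ipoly (pderiv f) \<theta> = ipoly h0 \<theta>"
    using hroot[OF root] by (simp add: G flip: rpoly_of_int)
  then show ?thesis unfolding R_iff by blast
qed

text \<open>The cofactor \<open>v(\<theta>)\<close> trades the multiplier
  \<open>f'(\<theta>)\<close> for an integer, so that residues modulo \<open>d\<close> can be
  counted.\<close>

lemma conductor:
  obtains d :: int where "d > 0" "\<And>x. x \<in> O_K \<Longrightarrow> of_int d * x \<in> R"
proof -
  obtain d v where dv: "(d::int) > 0"
    "\<And>x. ipoly f x = 0 \<Longrightarrow> ipoly v x * ipoly (pderiv f) x = of_int d"
    using pderiv_bezout by blast
  have "of_int d * x \<in> R" if "x \<in> O_K" for x
  proof -
    have "of_int d * x = ipoly v \<theta> * (x * ipoly (pderiv f) \<theta>)"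
      by (simp flip: dv(2)[OF root])
    moreover have "ipoly v \<theta> \<in> R" unfolding R_iff by blast
    ultimately show ?thesis using mult_pderiv_in_R[OF that] R_closed(2) by metis
  qed
  with dv(1) show ?thesis by (rule that)
qed

end

section \<open>Prime divisors of the index\<close>

text \<open>Left to right is Cauchy's theorem, drawn from a Sylow subgroup of order
  \<open>p\<close>; conversely, if \<open>p\<close> is prime to the order, a Bezout combination of
  the two exponents kills \<open>x\<close>.\<close>

lemma (in comm_group) dvd_order_iff_torsion:
  assumes fin: "finite (carrier G)" and p: "prime p"
  shows "p dvd order G \<longleftrightarrow> (\<exists>x\<in>carrier G. x \<noteq> \<one> \<and> x [^] p = \<one>)"
proof
  assume "p dvd order G"
  then obtain m where "order G = p ^ 1 * m" by auto
  then obtain H where H: "subgroup H G" "card H = p ^ 1"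
    using sylow_thm[OF p is_group _ fin] by blast
  interpret H: comm_group "G\<lparr>carrier := H\<rparr>"
    using group.group_comm_groupI[OF subgroup.subgroup_is_group[OF H(1) is_group]]
      m_comm subgroup.mem_carrier[OF H(1)] by auto
  have cH: "card H = p" using H(2) by simp
  then have "\<not> H \<subseteq> {\<one>}"
    using prime_gt_1_nat[OF p] card_mono[of "{\<one>}" H] by auto
  then obtain x where x: "x \<in> H" "x \<noteq> \<one>" by auto
  have "finite H" using H(1) fin by (metis finite_subset subgroup.subset)
  then have "x [^]\<^bsub>G\<lparr>carrier := H\<rparr>\<^esub> p = \<one>"
    using H.power_order_eq_one[of x] x cH by simp
  then have "x [^] p = \<one>" using nat_pow_consistent[of x p H] by simp
  then show "\<exists>x\<in>carrier G. x \<noteq> \<one> \<and> x [^] p = \<one>"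
    using x subgroup.mem_carrier[OF H(1)] by auto
next
  assume "\<exists>x\<in>carrier G. x \<noteq> \<one> \<and> x [^] p = \<one>"
  then obtain x where x: "x \<in> carrier G" "x \<noteq> \<one>" "x [^] p = \<one>" by auto
  show "p dvd order G"
  proof (rule ccontr)
    assume "\<not> p dvd order G"
    then have "coprime (int p) (int (order G))"
      using p by (simp add: prime_imp_coprime)
    then obtain u v where uv: "u * int p + v * int (order G) = 1"
      using bezout_int[of "int p" "int (order G)"] by auto
    have o: "x [^] order G = \<one>"
      using power_order_eq_one[OF fin x(1)] by (simp add: order_def)
    have "x = x [^] (int p * u + int (order G) * v)"
      using uv x(1) by (simp add: mult.commute)
    also have "\<dots> = \<one>"
      using x o by (simp add: int_pow_mult flip: int_pow_pow add: int_pow_int)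
    finally show False using x(2) by simp
  qed
qed

context monic_irreducible
begin

text \<open>With \<open>d\<close> from \<open>conductor\<close>, the class of \<open>x\<close>
  depends only on \<open>d x\<close> modulo \<open>d Z[\<theta>]\<close>, hence on
  \<open>degree f\<close> residues modulo \<open>d\<close>. Lists in \<open>S\<close> that do not
  come from an integral element merely enlarge the finite superset.\<close>

lemma finite_quotient:
  "finite (O_K // {(x, y). x \<in> O_K \<and> y \<in> O_K \<and> x - y \<in> R})" (is "finite (_ // ?r)")
proof -
  obtain d :: int where d: "d > 0" "\<And>x. x \<in> O_K \<Longrightarrow> of_int d * x \<in> R"
    using conductor by blast
  define S where "S = {xs. set xs \<subseteq> {0..<d} \<and> length xs = degree f}"
  define cls where "cls xs = {y \<in> O_K. ipoly (Poly xs) \<theta> / of_int d - y \<in> R}" for xs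
  have "O_K // ?r \<subseteq> cls ` S"
  proof
    fix X assume "X \<in> O_K // ?r"
    then obtain x where x: "x \<in> O_K" "X = ?r `` {x}" by (auto elim: quotientE)
    obtain g where g: "of_int d * x = ipoly g \<theta>" using d(2)[OF x(1)] by (auto simp: R_iff)
    obtain q r where qr: "g = q * f + r" "r = 0 \<or> degree r < degree f"
      using monic_division[OF monic] by blast
    define xs where "xs = map (\<lambda>i. coeff r i mod d) [0..<degree f]"
    have xs: "xs \<in> S" using d(1) by (auto simp: S_def xs_def)
    define k where "k = map_poly (\<lambda>c. c div d) r"
    have "r = Poly xs + smult d k"
    proof (rule poly_eqI)
      fix i
      show "coeff r i = coeff (Poly xs + smult d k) i"
      proof (cases "i < degree f")
        case True
        then show ?thesis by (simp add: k_def xs_def coeff_map_poly nth_default_def)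
      next
        case False
        with qr(2) have "coeff r i = 0" by (auto intro: coeff_eq_0)
        with False show ?thesis by (simp add: k_def xs_def coeff_map_poly nth_default_def)
      qed
    qed
    then have "of_int d * x = ipoly (Poly xs) \<theta> + of_int d * ipoly k \<theta>"
      using g qr(1) root by simp
    then have "ipoly (Poly xs) \<theta> = of_int d * (x - ipoly k \<theta>)"
      by (simp only: right_diff_distrib add_diff_cancel_right')
    with d(1) have xe: "ipoly (Poly xs) \<theta> / of_int d = x - ipoly k \<theta>"
      by simp
    have kR: "ipoly k \<theta> \<in> R" unfolding R_iff by blast
    have "x - ipoly k \<theta> - y \<in> R \<longleftrightarrow> x - y \<in> R" for y
    proof
      show "x - y \<in> R" if "x - ipoly k \<theta> - y \<in> R"
        using R_closed(1)[OF that kR] by (simp add: algebra_simps)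
      show "x - ipoly k \<theta> - y \<in> R" if "x - y \<in> R"
        using R_closed(3)[OF that kR] by (simp add: algebra_simps)
    qed
    then have "X = cls xs"
      unfolding x(2) cls_def xe using x(1) by auto
    with xs show "X \<in> cls ` S" by blast
  qed
  moreover have "finite S" unfolding S_def by (rule finite_lists_length_eq) simp
  ultimately show ?thesis by (meson finite_imageI finite_subset)
qed

text \<open>The index is the order of the finite group \<open>O_K / R\<close>, so \<open>p\<close>
  divides it iff there is a class of order \<open>p\<close>; such a class is represented by
  \<open>y\<close>.\<close>

lemma prime_dvd_index_iff:
  assumes p: "prime p"
  shows "p dvd order_index \<theta> \<longleftrightarrow> (\<exists>y\<in>O_K - R. of_nat p * y \<in> R)"
proof -
  define G :: "complex monoid" where "G = \<lparr>carrier = O_K, monoid.mult = (+), one = 0\<rparr>"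
  have "comm_group G"
    unfolding G_def using R_closed(5) R_subset_O
    by (intro comm_groupI) (auto simp: O_closed intro!: bexI[of _ "- _"])
  then interpret G: comm_group G .
  have "subgroup R G"
  proof (rule G.subgroupI)
    show "inv\<^bsub>G\<^esub> a \<in> R" if "a \<in> R" for a
    proof -
      have "inv\<^bsub>G\<^esub> a = - a"
        using that R_subset_O O_closed(3)[of a a] by (intro G.inv_equality) (auto simp: G_def)
      then show ?thesis using R_closed(4)[OF that] by simp
    qed
  qed (use R_subset_O R_closed in \<open>auto simp: G_def\<close>)
  note sub = this
  then interpret R: normal R G by (rule G.subgroup_imp_normal)
  let ?Q = "G Mod R"
  let ?r = "{(x, y). x \<in> O_K \<and> y \<in> O_K \<and> x - y \<in> R}"
  have Q: "comm_group ?Q" using G.abelian_FactGroup[OF sub] .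
  then interpret Q: comm_group ?Q .
  have coset: "?r `` {x} = r_coset G R x" if "x \<in> O_K" for x
  proof -
    have "x - y \<in> R \<longleftrightarrow> y - x \<in> R" for y
      using R_closed(4)[of "x - y"] R_closed(4)[of "y - x"] by auto
    moreover have "y \<in> O_K" if "y - x \<in> R" for y
      using O_closed(1)[of x "y - x"] \<open>x \<in> O_K\<close> that R_subset_O by auto
    ultimately have "?r `` {x} = {y. y - x \<in> R}" using that by auto
    also have "\<dots> = r_coset G R x"
      by (force simp: r_coset_def G_def)
    finally show ?thesis .
  qed
  have carr: "carrier ?Q = O_K // ?r"
    unfolding carrier_FactGroup quotient_def using coset by (auto simp: G_def)
  have fin: "finite (carrier ?Q)" using finite_quotient carr by simp
  have pw: "r_coset G R x [^]\<^bsub>?Q\<^esub> k = r_coset G R (of_nat k * x)" if "x \<in> O_K" for x k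
  proof (induction k)
    case 0
    then show ?case using G.coset_join2[OF _ sub, of 0] R_closed(5) R_subset_O
      by (auto simp: G_def)
  next
    case (Suc k)
    have "of_nat k * x \<in> O_K" using that R_closed(6)[of "int k"] R_subset_O O_closed(2) by auto
    with R.rcos_sum[of "of_nat k * x" x] that Suc show ?case
      by (simp add: G_def algebra_simps)
  qed
  have one: "r_coset G R x = R \<longleftrightarrow> x \<in> R" if "x \<in> O_K" for x
    using G.coset_join1[OF _ _ sub, of x] G.coset_join2[OF _ sub, of x] that
    by (auto simp: G_def)
  have pO: "of_nat p * x \<in> O_K" if "x \<in> O_K" for x
    using that R_closed(6)[of "int p"] R_subset_O O_closed(2) by auto
  have "order_index \<theta> = order ?Q"
    by (simp add: order_index_def order_def carr)
  then have "p dvd order_index \<theta> \<longleftrightarrow> (\<exists>X\<in>carrier ?Q. X \<noteq> R \<and> X [^]\<^bsub>?Q\<^esub> p = R)"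
    using Q.dvd_order_iff_torsion[OF fin p] by simp
  also have "\<dots> \<longleftrightarrow> (\<exists>y\<in>O_K. y \<notin> R \<and> of_nat p * y \<in> R)"
    unfolding carrier_FactGroup using one pw pO by (auto simp: G_def)
  finally show ?thesis by auto
qed

end

section \<open>Dedekind's criterion\<close>

text \<open>\<open>mod_dvd p d g\<close> says that \<open>g\<close> lies in the ideal \<open>(p, d)\<close>, that is, \<open>d\<close> divides \<open>g\<close> in
  \<open>\<F>\<^sub>p[X]\<close>.\<close>

definition mod_dvd :: "int \<Rightarrow> int poly \<Rightarrow> int poly \<Rightarrow> bool" where
  "mod_dvd p d g \<longleftrightarrow> (\<exists>q r. g = q * d + smult p r)"

text \<open>A monic lift of an irreducible polynomial over the field with \<open>p\<close> elements,
  for prime \<open>p\<close>. Irreducibility is stated as primality of the ideal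
  \<open>(p, \<pi>)\<close> of Z[X], the form in which it is applied; the positive degree excludes
  the unit ideal.\<close>

definition mod_prime :: "int \<Rightarrow> int poly \<Rightarrow> bool" where
  "mod_prime p \<pi> \<longleftrightarrow> lead_coeff \<pi> = 1 \<and> degree \<pi> > 0 \<and>
     (\<forall>g h. mod_dvd p \<pi> (g * h) \<longrightarrow> mod_dvd p \<pi> g \<or> mod_dvd p \<pi> h)"

lemma mod_dvd_add: "mod_dvd p d g \<Longrightarrow> mod_dvd p d h \<Longrightarrow> mod_dvd p d (g + h)"
proof -
  assume "mod_dvd p d g" "mod_dvd p d h"
  then obtain q r q' r' where "g = q * d + smult p r" "h = q' * d + smult p r'"
    unfolding mod_dvd_def by blast
  then have "g + h = (q + q') * d + smult p (r + r')"
    by (simp add: algebra_simps smult_add_right)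
  then show ?thesis unfolding mod_dvd_def by blast
qed

lemma mod_dvd_mult: "mod_dvd p d g \<Longrightarrow> mod_dvd p d (h * g)"
proof -
  assume "mod_dvd p d g"
  then obtain q r where "g = q * d + smult p r"
    unfolding mod_dvd_def by blast
  then have "h * g = (h * q) * d + smult p (h * r)"
    by (simp add: algebra_simps)
  then show ?thesis unfolding mod_dvd_def by blast
qed

lemma mod_dvd_mult2: "mod_dvd p d g \<Longrightarrow> mod_dvd p d (g * h)"
  using mod_dvd_mult[of p d g h] by (simp add: mult.commute)

lemma mod_dvd_smult: "mod_dvd p d (smult p r)"
  unfolding mod_dvd_def by (rule exI[of _ 0]) auto

lemma mod_dvd_self: "mod_dvd p d d"
  unfolding mod_dvd_def by (rule exI[of _ 1], rule exI[of _ 0]) simp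

lemma mod_dvd_0: "mod_dvd p d 0"
  using mod_dvd_smult[of p d 0] by simp

lemma mod_dvd_minus: "mod_dvd p d g \<Longrightarrow> mod_dvd p d (- g)"
  using mod_dvd_mult[of p d g "- 1"] by simp

lemma mod_dvd_diff: "mod_dvd p d g \<Longrightarrow> mod_dvd p d h \<Longrightarrow> mod_dvd p d (g - h)"
  using mod_dvd_add[OF _ mod_dvd_minus, of p d g h] by simp

lemma mod_dvd_sum: "(\<And>i. i \<in> A \<Longrightarrow> mod_dvd p d (g i)) \<Longrightarrow> mod_dvd p d (\<Sum>i\<in>A. g i)"
  by (induction A rule: infinite_finite_induct) (auto intro: mod_dvd_0 mod_dvd_add)

lemma mod_dvd_cancel: "mod_dvd p d (g + h) \<Longrightarrow> mod_dvd p d h \<Longrightarrow> mod_dvd p d g"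
  using mod_dvd_diff[of p d "g + h" h] by simp

lemma mod_dvd_trans: "mod_dvd p d e \<Longrightarrow> mod_dvd p e g \<Longrightarrow> mod_dvd p d g"
  unfolding mod_dvd_def[of p e g] by (auto intro!: mod_dvd_add mod_dvd_mult mod_dvd_smult)

section \<open>Monic generators and irreducible factors modulo \<open>p\<close>\<close>

lemma mod_dvd_normal_form:
  assumes d: "lead_coeff d = 1" and "mod_dvd p d g"
  obtains q r where "g = q * d + smult p r" "r = 0 \<or> degree r < degree d"
proof -
  obtain q r where qr: "g = q * d + smult p r" using assms(2) unfolding mod_dvd_def by blast
  obtain q' r' where q'r': "r = q' * d + r'" "r' = 0 \<or> degree r' < degree d"
    using monic_division[OF d] by blast
  have "g = (q + smult p q') * d + smult p r'"
    unfolding qr q'r'(1) by (simp add: algebra_simps smult_add_right)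
  then show ?thesis using q'r'(2) by (rule that)
qed

text \<open>Once the remainder has degree below \<open>d\<close>, the term \<open>smult p r\<close>
  cannot reach the leading term of \<open>q * d\<close>, which is therefore that of
  \<open>g\<close>. The quotient \<open>q = 0\<close> is excluded because \<open>p\<close> would
  divide the leading coefficient 1.\<close>

lemma mod_dvd_monic:
  fixes d g :: "int poly"
  assumes p: "p > 1" and d: "lead_coeff d = 1" and g: "lead_coeff g = 1" and dg: "mod_dvd p d g"
  obtains q r where "g = q * d + smult p r" "r = 0 \<or> degree r < degree d"
    "lead_coeff q = 1" "degree g = degree q + degree d"
proof -
  obtain q r where qr: "g = q * d + smult p r" "r = 0 \<or> degree r < degree d"
    using mod_dvd_normal_form[OF d dg] by blast
  have d0: "d \<noteq> 0" using d by auto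
  have q0: "q \<noteq> 0"
  proof
    assume "q = 0"
    then have "lead_coeff g = p * lead_coeff r" using qr(1) p by simp
    then show False using g p by (simp add: zmult_eq_1_iff)
  qed
  have dq: "degree (q * d) = degree q + degree d" by (rule degree_mult_eq[OF q0 d0])
  show thesis
  proof (cases "r = 0")
    case True
    then have gq: "g = q * d" using qr by simp
    then have "lead_coeff q * lead_coeff d = 1" "degree g = degree q + degree d"
      using g dq by (simp_all flip: lead_coeff_mult)
    then show thesis using that[OF qr] d by simp
  next
    case False
    then have *: "degree (smult p r) < degree (q * d)" using qr(2) p dq by simp
    then have "degree g = degree (q * d)"
      unfolding qr(1) by (rule degree_add_eq_left)
    moreover have "lead_coeff g = lead_coeff (q * d)"
      unfolding qr(1) using lead_coeff_add_le[OF *] by (simp add: add.commute)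
    ultimately have "lead_coeff q * lead_coeff d = 1" "degree g = degree q + degree d"
      using g dq by (simp_all flip: lead_coeff_mult)
    then show thesis using that[OF qr] d by simp
  qed
qed

lemma monic_degree_0: "lead_coeff (g :: int poly) = 1 \<Longrightarrow> degree g = 0 \<Longrightarrow> g = 1"
  by (metis degree_0_id lead_coeff_pCons(2) monom_0 one_pCons of_int_1 degree_eq_zeroE
      coeff_pCons_0 degree_pCons_0)

lemma mod_principal:
  fixes J :: "int poly set"
  assumes p: "prime (p :: int)"
    and add: "\<And>g h. g \<in> J \<Longrightarrow> h \<in> J \<Longrightarrow> g + h \<in> J"
    and mult: "\<And>g h. h \<in> J \<Longrightarrow> g * h \<in> J"
    and pJ: "[:p:] \<in> J" and G: "G \<in> J" "\<nexists>r. G = smult p r"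
  obtains d where "d \<in> J" "lead_coeff d = 1" "\<And>g. g \<in> J \<Longrightarrow> mod_dvd p d g"
proof -
  have psm: "smult p r \<in> J" for r using mult[OF pJ, of r] by simp
  have diff: "g - h \<in> J" if "g \<in> J" "h \<in> J" for g h
    using add[OF that(1) mult[OF that(2), of "- 1"]] by simp
  have red: "\<exists>d\<in>J. lead_coeff d = 1 \<and> degree d \<le> degree g"
    if "g \<in> J" "\<nexists>r. g = smult p r" for g
    using that
  proof (induction "degree g" arbitrary: g rule: less_induct)
    case less
    show ?case
    proof (cases "p dvd lead_coeff g")
      case True
      then obtain c where c: "lead_coeff g = p * c" by auto
      define h where "h = g - monom (lead_coeff g) (degree g)"
      have m: "monom (lead_coeff g) (degree g) = smult p (monom c (degree g))"
        by (simp add: c smult_monom)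
      have hJ: "h \<in> J" unfolding h_def m by (rule diff[OF less.prems(1) psm])
      have hp: "\<nexists>r. h = smult p r"
      proof
        assume "\<exists>r. h = smult p r"
        then obtain r where "h = smult p r" by auto
        then have "g = smult p (r + monom c (degree g))"
          unfolding h_def m by (simp add: smult_add_right algebra_simps)
        then show False using less.prems(2) by blast
      qed
      have dh: "degree h < degree g"
      proof -
        have "coeff h i = 0" if "i \<ge> degree g" for i
          using that by (cases "i = degree g") (auto simp: h_def coeff_eq_0)
        moreover have "h \<noteq> 0" using hp by (metis smult_0_right)
        ultimately show ?thesis by (meson leading_coeff_0_iff not_less)
      qed
      from less.hyps[OF dh hJ hp] dh show ?thesis by auto
    next
      case False
      then have "coprime p (lead_coeff g)" using p by (simp add: prime_imp_coprime)
      then obtain u v where uv: "u * p + v * lead_coeff g = 1"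
        using bezout_int[of p "lead_coeff g"] by auto
      define d where "d = smult p (monom u (degree g)) + smult v g"
      have dJ: "d \<in> J" unfolding d_def using mult[OF less.prems(1), of "[:v:]"]
        by (intro add psm) simp
      have c1: "coeff d (degree g) = 1" using uv by (simp add: d_def mult.commute)
      have dd: "degree d \<le> degree g"
        unfolding d_def by (intro degree_add_le order.trans[OF degree_smult_le] degree_monom_le) auto
      moreover have "degree g \<le> degree d" using c1 by (intro le_degree) simp
      ultimately show ?thesis using c1 dJ by (intro bexI[of _ d]) auto
    qed
  qed
  then obtain d0 where "d0 \<in> J \<and> lead_coeff d0 = 1" using G by blast
  from ex_has_least_nat[of "\<lambda>d. d \<in> J \<and> lead_coeff d = 1", OF this, of degree]
  obtain d where d: "d \<in> J" "lead_coeff d = 1"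
    and min: "\<And>e. e \<in> J \<Longrightarrow> lead_coeff e = 1 \<Longrightarrow> degree d \<le> degree e" by blast
  show thesis
  proof (rule that[OF d])
    fix g assume g: "g \<in> J"
    obtain q r where qr: "g = q * d + r" "r = 0 \<or> degree r < degree d"
      using monic_division[OF d(2)] by blast
    have "r \<in> J" using diff[OF g mult[OF d(1), of q]] qr(1) by simp
    \<comment> \<open>Otherwise \<open>red\<close> would turn \<open>r\<close> into a monic element
      of \<open>J\<close> of degree below that of \<open>d\<close>.\<close>
    then have "\<exists>s. r = smult p s"
      using red[of r] qr(2) min by (metis leD le_less_trans smult_0_right)
    then show "mod_dvd p d g" using qr(1) unfolding mod_dvd_def by blast
  qed
qed

text \<open>Take \<pi> of least positive degree among the monic divisors of \<open>k\<close> modulo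
  \<open>p\<close>. If \<pi> divides \<open>g * h\<close> but not \<open>g\<close>, let
  \<open>d\<close> generate \<open>(p, \<pi>, g)\<close>. Positive degree would by minimality make
  \<open>d\<close> equal to \<pi> modulo \<open>p\<close>, so that \<pi> divides \<open>g\<close>;
  hence \<open>d = 1\<close>, and the resulting Bezout identity times \<open>h\<close> shows that
  \<pi> divides \<open>h\<close>.\<close>

lemma mod_prime_divisor:
  fixes k :: "int poly"
  assumes p: "prime (p :: int)" and k: "lead_coeff k = 1" "degree k > 0"
  obtains \<pi> where "mod_prime p \<pi>" "mod_dvd p \<pi> k"
proof -
  let ?P = "\<lambda>d. lead_coeff d = 1 \<and> degree d > 0 \<and> mod_dvd p d k"
  have p1: "p > 1" using p by (rule prime_gt_1_int)
  have "?P k" using k mod_dvd_self by simp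
  from ex_has_least_nat[of ?P, OF this, of degree]
  obtain \<pi> where \<pi>: "lead_coeff \<pi> = 1" "degree \<pi> > 0" "mod_dvd p \<pi> k"
    and min: "\<And>e. ?P e \<Longrightarrow> degree \<pi> \<le> degree e" by blast
  have "mod_dvd p \<pi> h" if gh: "mod_dvd p \<pi> (g * h)" and ng: "\<not> mod_dvd p \<pi> g" for g h
  proof -
    define J where "J = {z. \<exists>A B C. z = A * \<pi> + B * g + smult p C}"
    have "a + b \<in> J" if ab: "a \<in> J" "b \<in> J" for a b
    proof -
      from ab obtain A B C A' B' C' where "a = A * \<pi> + B * g + smult p C"
        "b = A' * \<pi> + B' * g + smult p C'" unfolding J_def by blast
      then have "a + b = (A + A') * \<pi> + (B + B') * g + smult p (C + C')"
        by (simp add: algebra_simps smult_add_right)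
      then show ?thesis unfolding J_def by blast
    qed
    moreover have "a * b \<in> J" if "b \<in> J" for a b
    proof -
      from that obtain A B C where "b = A * \<pi> + B * g + smult p C" unfolding J_def by blast
      then have "a * b = (a * A) * \<pi> + (a * B) * g + smult p (a * C)"
        by (simp add: algebra_simps)
      then show ?thesis unfolding J_def by blast
    qed
    moreover have pi_g: "\<pi> \<in> J" "g \<in> J" "[:p:] \<in> J"
    proof -
      have "\<pi> = 1 * \<pi> + 0 * g + smult p 0" "g = 0 * \<pi> + 1 * g + smult p 0"
        "[:p:] = 0 * \<pi> + 0 * g + smult p 1" by simp_all
      then show "\<pi> \<in> J" "g \<in> J" "[:p:] \<in> J" unfolding J_def by blast+
    qed
    moreover have "\<nexists>r. g = smult p r" using ng mod_dvd_smult by blast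
    ultimately obtain d where d: "d \<in> J" "lead_coeff d = 1" "\<And>g. g \<in> J \<Longrightarrow> mod_dvd p d g"
      using mod_principal[OF p, of J g] by metis
    obtain q r where qr: "\<pi> = q * d + smult p r" "lead_coeff q = 1" "degree \<pi> = degree q + degree d"
      using mod_dvd_monic[OF p1 d(2) \<pi>(1) d(3)[OF pi_g(1)]] by blast
    have "degree d = 0"
    proof (rule ccontr)
      assume "degree d \<noteq> 0"
      moreover have "mod_dvd p d k" using mod_dvd_trans[OF d(3)[OF pi_g(1)] \<pi>(3)] .
      ultimately have "degree \<pi> \<le> degree d" using min d(2) by blast
      then have "degree q = 0" using qr(3) by simp
      then have "q = 1" using qr(2) monic_degree_0 by blast
      then have "d = 1 * \<pi> + smult p (- r)" using qr(1) by simp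
      then have "mod_dvd p \<pi> d" unfolding mod_dvd_def by blast
      then have "mod_dvd p \<pi> g" using mod_dvd_trans d(3)[OF pi_g(2)] by blast
      with ng show False ..
    qed
    then have "d = 1" using d(2) monic_degree_0 by blast
    then obtain A B C where "1 = A * \<pi> + B * g + smult p C" using d(1) unfolding J_def by blast
    then have "h = (A * \<pi> + B * g + smult p C) * h" by simp
    also have "\<dots> = (A * h) * \<pi> + B * (g * h) + smult p (C * h)"
      by (simp add: algebra_simps)
    also have "mod_dvd p \<pi> \<dots>"
      by (intro mod_dvd_add mod_dvd_mult mod_dvd_self mod_dvd_smult gh)
    finally show ?thesis .
  qed
  then have "mod_prime p \<pi>" using \<pi> unfolding mod_prime_def by blast
  with \<pi>(3) show thesis using that by blast
qed

lemma mod_prime_not_1: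
  assumes "p > 1" "mod_prime p \<pi>"
  shows "\<not> mod_dvd p \<pi> 1"
proof
  assume "mod_dvd p \<pi> 1"
  with mod_dvd_monic[OF assms(1), of \<pi> 1] assms(2) show False
    unfolding mod_prime_def by (metis degree_1 add_is_0 lead_coeff_1 less_numeral_extra(3))
qed

lemma mod_prime_power:
  assumes "p > 1" "mod_prime p \<pi>" "mod_dvd p \<pi> (g ^ m)"
  shows "mod_dvd p \<pi> g"
  using assms(3) mod_prime_not_1[OF assms(1,2)] assms(2)
  by (induction m) (auto simp: mod_prime_def)

context monic_irreducible
begin

text \<open>An elementary form of lying over: the prime ideal \<open>(p, \<pi>(\<theta>))\<close> of
  Z[\<theta>] does not grow when it is extended to the integers and contracted back. The monic
  equation of \<open>y\<close>, homogenised to \<open>B^m P(A/B)\<close>, vanishes at \<theta> and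
  so is a multiple of \<open>f\<close>; all its terms except \<open>A^m\<close> contain
  \<open>B\<close>.\<close>

lemma algebraic_int_quotient_mod_dvd:
  assumes p: "p > 1" and \<pi>: "mod_prime p \<pi>" and f: "mod_dvd p \<pi> f" and B: "mod_dvd p \<pi> B"
    and y: "algebraic_int y" and AB: "ipoly A \<theta> = y * ipoly B \<theta>"
  shows "mod_dvd p \<pi> A"
proof -
  obtain P where P: "ipoly P y = 0" "lead_coeff P = 1"
    using y unfolding algebraic_int_altdef_ipoly ipoly_def by auto
  define m where "m = degree P"
  define V where "V = (\<Sum>i<m. smult (coeff P i) (A ^ i * B ^ (m - i)))"
  define W where "W = V + A ^ m"
  have W: "W = (\<Sum>i\<le>m. smult (coeff P i) (A ^ i * B ^ (m - i)))"
    using P(2) by (simp add: W_def V_def m_def lessThan_Suc_atMost[symmetric] del: lessThan_Suc_atMost)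
  have "ipoly W \<theta> = (\<Sum>i\<le>m. of_int (coeff P i) * y ^ i * ipoly B \<theta> ^ m)"
    unfolding W ipoly_sum
    by (intro sum.cong) (auto simp: AB power_mult_distrib mult_ac simp flip: power_add)
  also have "\<dots> = ipoly P y * ipoly B \<theta> ^ m"
    by (simp add: ipoly_altdef m_def sum_distrib_right)
  finally have "f dvd W" using P(1) by (intro ipoly_zero_imp_dvd) simp
  then have W': "mod_dvd p \<pi> W" using mod_dvd_mult[OF f] by (auto elim!: dvdE simp: mult.commute)
  have "mod_dvd p \<pi> V"
    unfolding V_def
  proof (intro mod_dvd_sum)
    fix i assume "i \<in> {..<m}"
    then obtain k where k: "m - i = Suc k" by (auto simp: Suc_diff_Suc dest!: less_imp_Suc_add)
    have "smult (coeff P i) (A ^ i * B ^ (m - i)) = (smult (coeff P i) (A ^ i) * B ^ k) * B"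
      unfolding k by (simp add: mult_ac)
    then show "mod_dvd p \<pi> (smult (coeff P i) (A ^ i * B ^ (m - i)))"
      using mod_dvd_mult[OF B] by metis
  qed
  then have "mod_dvd p \<pi> (A ^ m)" using W' mod_dvd_cancel[of p \<pi> "A ^ m" V]
    by (simp add: W_def add.commute)
  then show ?thesis by (rule mod_prime_power[OF p \<pi>])
qed

text \<open>Dedekind's criterion, in the form: \<open>p\<close> divides the index iff \<open>f\<close> lies in
  \<open>(p, \<pi>)\<^sup>2\<close> for some \<open>\<pi>\<close>. With \<open>d\<close> generating the ideal of those \<open>g\<close> for which
  \<open>g(\<theta>)/p\<close> is integral, \<open>\<pi>\<close> is an irreducible factor of \<open>f/d\<close> modulo \<open>p\<close>.\<close>

lemma prime_dvd_index_imp: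
  assumes p: "prime p" and dvd: "p dvd order_index \<theta>"
  obtains \<pi> s t u where "mod_prime (int p) \<pi>"
    "f = \<pi>\<^sup>2 * s + smult (int p) (\<pi> * t) + smult ((int p)\<^sup>2) u"
proof -
  have p': "prime (int p)" and p1: "int p > 1"
    using p prime_gt_1_nat[OF p] by auto
  obtain y where y: "y \<in> O_K" "y \<notin> R" "of_nat p * y \<in> R"
    using dvd prime_dvd_index_iff[OF p] by auto
  obtain G where G: "of_nat p * y = ipoly G \<theta>" using y(3) by (auto simp: R_iff)
  have pc: "(of_nat p :: complex) \<noteq> 0" using p1 by auto
  define I where "I = {g. ipoly g \<theta> / of_nat p \<in> O_K}"
  have RO: "ipoly g \<theta> \<in> O_K" for g using R_subset_O R_iff by blast
  have mI: "g * h \<in> I" if "h \<in> I" for g h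
    using O_closed(2)[OF RO[of g], of "ipoly h \<theta> / of_nat p"] that by (simp add: I_def)
  have aI: "g + h \<in> I" if "g \<in> I" "h \<in> I" for g h
    using O_closed(1)[of "ipoly g \<theta> / of_nat p" "ipoly h \<theta> / of_nat p"] that
    by (simp add: I_def add_divide_distrib)
  have pI: "[:int p:] \<in> I" using RO[of 1] pc by (simp add: I_def)
  have "y = ipoly G \<theta> / of_nat p" using G pc by (simp add: field_simps)
  then have GI: "G \<in> I" using y(1) by (simp add: I_def)
  have Gp: "\<nexists>r. G = smult (int p) r"
  proof
    assume "\<exists>r. G = smult (int p) r"
    then obtain r where "G = smult (int p) r" ..
    then have "y = ipoly r \<theta>" using G pc by simp
    then show False using y(2) by (auto simp: R_iff)
  qed
  have fI: "f \<in> I" using RO[of 0] by (simp add: I_def root)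
  obtain d where d: "d \<in> I" "lead_coeff d = 1" "\<And>g. g \<in> I \<Longrightarrow> mod_dvd (int p) d g"
    using mod_principal[OF p' aI mI pI GI Gp] by metis
  obtain k r where kr: "f = k * d + smult (int p) r" "lead_coeff k = 1"
    using mod_dvd_monic[OF p1 d(2) monic d(3)[OF fI]] by blast
  \<comment> \<open>If \<open>k\<close> were constant, \<open>d\<close> would equal \<open>f\<close>
    modulo \<open>p\<close>. Then \<open>d(\<theta>)\<close> and with it \<open>G(\<theta>)\<close>
    would lie in \<open>p R\<close>, contrary to the choice of \<open>y\<close> outside
    \<open>R\<close>.\<close>
  have "degree k > 0"
  proof (rule ccontr)
    assume "\<not> degree k > 0"
    then have "k = 1" using kr(2) monic_degree_0 by blast
    then have fd: "d = f - smult (int p) r" using kr(1) by simp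
    obtain q r' where Gq: "G = q * d + smult (int p) r'"
      using d(3)[OF GI] unfolding mod_dvd_def by blast
    then have "of_nat p * y = of_nat p * ipoly (r' - q * r) \<theta>"
      unfolding G Gq fd by (simp add: root algebra_simps)
    then have "y = ipoly (r' - q * r) \<theta>" using pc by (metis mult_left_cancel)
    then have "y \<in> R" unfolding R_iff by blast
    with y(2) show False ..
  qed
  then obtain \<pi> where \<pi>: "mod_prime (int p) \<pi>" "mod_dvd (int p) \<pi> k"
    using mod_prime_divisor[OF p' kr(2)] by blast
  obtain \<kappa> k1 where k: "k = \<kappa> * \<pi> + smult (int p) k1" using \<pi>(2) unfolding mod_dvd_def by blast
  \<comment> \<open>This is the classical shape of the criterion: \<open>h\<close> is
    \<open>f / \<pi>\<close> modulo \<open>p\<close> and still belongs to \<open>I\<close>. It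
    remains to see that \<pi> divides both \<open>h\<close> and \<open>F\<close> modulo
    \<open>p\<close>.\<close>
  define h F where "h = \<kappa> * d" and "F = k1 * d + r"
  have f: "f = \<pi> * h + smult (int p) F"
    unfolding kr(1) k h_def F_def by (simp add: algebra_simps smult_add_right)
  have hI: "algebraic_int (ipoly h \<theta> / of_nat p)"
    using mI[OF d(1), of \<kappa>] by (simp add: h_def I_def O_iff)
  have fpi: "mod_dvd (int p) \<pi> f"
    unfolding f by (intro mod_dvd_add mod_dvd_mult2 mod_dvd_self mod_dvd_smult)
  \<comment> \<open>For \<open>h\<close>, write \<open>h(\<theta>)\<close> as the integral number
    \<open>h(\<theta>)/p\<close> times the constant \<open>p\<close>.\<close>
  have "mod_dvd (int p) \<pi> [:int p:]" using mod_dvd_smult[of "int p" \<pi> 1] by simp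
  from algebraic_int_quotient_mod_dvd[OF p1 \<pi>(1) fpi this hI, of h]
  have "mod_dvd (int p) \<pi> h" using pc by simp
  then obtain s h' where h: "h = s * \<pi> + smult (int p) h'" unfolding mod_dvd_def by blast
  \<comment> \<open>For \<open>F\<close>, evaluating \<open>f\<close> at its root makes
    \<open>F(\<theta>)\<close> an integral multiple of \<open>\<pi>(\<theta>)\<close>.\<close>
  have "of_nat p * ipoly F \<theta> = - (ipoly \<pi> \<theta> * ipoly h \<theta>)"
    using arg_cong[OF f, of "\<lambda>g. ipoly g \<theta>"] root by (simp add: eq_neg_iff_add_eq_0 add.commute)
  then have "ipoly F \<theta> = - (ipoly h \<theta> / of_nat p) * ipoly \<pi> \<theta>"
    using pc by (simp add: field_simps)
  from algebraic_int_quotient_mod_dvd[OF p1 \<pi>(1) fpi mod_dvd_self _ this]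
  have "mod_dvd (int p) \<pi> F" using hI by (simp only: algebraic_int_minus_iff)
  then obtain t u where F: "F = t * \<pi> + smult (int p) u" unfolding mod_dvd_def by blast
  have "f = \<pi>\<^sup>2 * s + smult (int p) (\<pi> * (h' + t)) + smult ((int p)\<^sup>2) u"
    unfolding f h F by (simp add: algebra_simps smult_add_right power2_eq_square)
  with \<pi>(1) show thesis by (rule that)
qed

text \<open>Conversely, \<open>y = \<pi>(\<theta>) s(\<theta>)/p\<close> satisfies \<open>y\<^sup>2 + t(\<theta>) y + s(\<theta>) u(\<theta>) = 0\<close>.\<close>

lemma prime_dvd_index:
  assumes p: "prime p" and f: "f = \<pi>\<^sup>2 * s + smult (int p) (\<pi> * t) + smult ((int p)\<^sup>2) u"
    and monic_s: "lead_coeff (\<pi> * s) = 1" and deg: "degree (\<pi> * s) < degree f"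
  shows "p dvd order_index \<theta>"
proof -
  have pc: "(of_nat p :: complex) \<noteq> 0" using prime_gt_0_nat[OF p] by auto
  define y where "y = ipoly (\<pi> * s) \<theta> / of_nat p"
  let ?v = "\<lambda>g. ipoly g \<theta>"
  have "?v \<pi> ^ 2 * ?v s + of_nat p * (?v \<pi> * ?v t) + of_nat p ^ 2 * ?v u = 0"
    using arg_cong[OF f, of ?v] root by simp
  then have "(?v \<pi> ^ 2 * ?v s + of_nat p * (?v \<pi> * ?v t) + of_nat p ^ 2 * ?v u) * ?v s
      / of_nat p ^ 2 = 0" by simp
  then have "y\<^sup>2 + ?v t * y + ?v (s * u) = 0"
    using pc by (simp add: y_def field_simps power2_eq_square)
  then have "algebraic_int y" by (rule algebraic_int_quadratic[OF algebraic_int_\<theta>])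
  moreover have "y = rpoly (smult (inverse (of_nat p)) (map_poly of_int (\<pi> * s))) \<theta>"
    by (simp add: y_def rpoly_of_int divide_inverse mult.commute of_rat_inverse)
  ultimately have yO: "y \<in> O_K" unfolding O_iff by blast
  have py: "of_nat p * y = ?v (\<pi> * s)" using pc by (simp add: y_def)
  have "y \<notin> R"
  proof
    assume "y \<in> R"
    then obtain g where g: "y = ?v g" by (auto simp: R_iff)
    obtain q r where qr: "g = q * f + r" "r = 0 \<or> degree r < degree f"
      using monic_division[OF monic] by blast
    \<comment> \<open>Both polynomials have degree below \<open>f\<close>, so equality at \<theta>
      is equality in Z[X]; but a monic polynomial is not a multiple of \<open>p\<close>.\<close>
    have "?v (\<pi> * s - smult (int p) r) = 0"
      using py g qr(1) root by simp
    moreover have "degree (\<pi> * s - smult (int p) r) < degree f"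
      using deg qr(2) by (intro degree_diff_less) (auto intro: le_less_trans[OF degree_smult_le])
    ultimately have "\<pi> * s = smult (int p) r" using ipoly_zero_small by fastforce
    then have "int p * lead_coeff r = 1" using monic_s pc by simp
    then show False using prime_gt_1_nat[OF p] by (simp add: zmult_eq_1_iff)
  qed
  moreover have "of_nat p * y \<in> R" unfolding py R_iff by blast
  ultimately show ?thesis using yO prime_dvd_index_iff[OF p] by blast
qed

end

section \<open>The discriminant\<close>

lemma prod_list_map_mult:
  "(\<Prod>x\<leftarrow>xs. g x * h x) = (\<Prod>x\<leftarrow>xs. g x) * (\<Prod>x\<leftarrow>xs. h x :: 'a :: comm_monoid_mult)"
  by (induction xs) (simp_all add: mult_ac)

lemma prod_list_map_power:
  "(\<Prod>x\<leftarrow>xs. g x ^ k) = (\<Prod>x\<leftarrow>xs. g x :: 'a :: comm_monoid_mult) ^ k"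
  by (induction xs) (simp_all add: power_mult_distrib)

lemma prod_list_map_const: "(\<Prod>x\<leftarrow>xs. c) = (c :: 'a :: comm_monoid_mult) ^ length xs"
  by (induction xs) simp_all

lemma poly_prod_linear: "poly (\<Prod>a\<leftarrow>as. [:- a, 1:]) x = (\<Prod>a\<leftarrow>as. x - a :: 'a :: comm_ring_1)"
  by (induction as) (simp_all add: algebra_simps)

lemma degree_prod_linear: "degree (\<Prod>a\<leftarrow>as. [:- a, 1 :: 'a :: idom:]) = length as"
  "lead_coeff (\<Prod>a\<leftarrow>as. [:- a, 1 :: 'a :: idom:]) = 1"
proof -
  have "degree (\<Prod>a\<leftarrow>as. [:- a, 1 :: 'a :: idom:]) = length as \<and>
      lead_coeff (\<Prod>a\<leftarrow>as. [:- a, 1 :: 'a :: idom:]) = 1"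
  proof (induction as)
    case (Cons a as)
    define P where "P = (\<Prod>a\<leftarrow>as. [:- a, 1 :: 'a:])"
    have P: "degree P = length as" "lead_coeff P = 1" using Cons unfolding P_def by auto
    then have "P \<noteq> 0" by auto
    then have "degree ([:- a, 1:] * P) = degree [:- a, 1:] + degree P"
      by (intro degree_mult_eq) auto
    then have "degree ([:- a, 1:] * P) = length (a # as)" using P(1) by simp
    moreover have "lead_coeff ([:- a, 1:] * P) = 1"
      by (subst lead_coeff_mult) (use P in simp)
    ultimately show ?case by (simp only: list.map prod_list.Cons P_def)
  qed simp
  then show "degree (\<Prod>a\<leftarrow>as. [:- a, 1 :: 'a :: idom:]) = length as"
    "lead_coeff (\<Prod>a\<leftarrow>as. [:- a, 1 :: 'a :: idom:]) = 1" by auto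
qed

lemma prod_list_diff_swap:
  "(\<Prod>c\<leftarrow>cs. \<Prod>b\<leftarrow>bs. c - b) =
    (- 1 :: 'a :: comm_ring_1) ^ (length bs * length cs) * (\<Prod>b\<leftarrow>bs. \<Prod>c\<leftarrow>cs. b - c)"
proof (induction bs)
  case Nil
  then show ?case by (simp add: prod_list_map_const)
next
  case (Cons b bs)
  have "(\<Prod>c\<leftarrow>cs. c - b) = (\<Prod>c\<leftarrow>cs. (- 1) * (b - c))" by simp
  also have "\<dots> = (- 1) ^ length cs * (\<Prod>c\<leftarrow>cs. b - c)"
    by (simp only: prod_list_map_mult prod_list_map_const)
  finally show ?case
    by (simp add: prod_list_map_mult Cons power_add mult_ac)
qed

text \<open>Euclidean induction on the number of roots. An \<open>F\<close> of smaller degree is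
  split over the complex numbers and swapped to the front, where the induction hypothesis applies to
  its fewer roots; the products of differences then agree up to the sign of the swap. Any other
  \<open>F\<close> is reduced modulo \<open>G\<close>, which leaves its values at the roots
  unchanged.\<close>

lemma resultant_prod_linear:
  fixes F :: "complex poly"
  shows "resultant (\<Prod>b\<leftarrow>bs. [:- b, 1:]) F = (\<Prod>b\<leftarrow>bs. poly F b)"
proof (induction "length bs" arbitrary: bs F rule: less_induct)
  case less
  define G :: "complex poly" where "G = (\<Prod>b\<leftarrow>bs. [:- b, 1:])"
  have dG: "degree G = length bs" and lG: "lead_coeff G = 1"
    unfolding G_def by (rule degree_prod_linear)+
  have G0: "G \<noteq> 0" using lG by auto
  show ?case
  proof (cases "bs = []")
    case False
    then have dpos: "degree G > 0" using dG by simp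
    have small: "resultant G H = (\<Prod>b\<leftarrow>bs. poly H b)" if H: "degree H < length bs" for H
    proof (cases "H = 0")
      case True
      then show ?thesis using dpos False by (cases bs) auto
    next
      case H0: False
      define c where "c = lead_coeff H"
      obtain cs where cs: "smult c (\<Prod>b\<leftarrow>cs. [:- b, 1:]) = H" "length cs = degree H"
        using fundamental_theorem_algebra_factorized[of H] by (auto simp: c_def)
      have c0: "c \<noteq> 0" using H0 by (simp add: c_def)
      have "resultant G H = (- 1) ^ (length bs * length cs) * resultant H G"
        by (simp add: resultant_swap[of G H] dG cs(2))
      also have "resultant H G = c ^ length bs * (\<Prod>c\<leftarrow>cs. poly G c)"
        using resultant_smult_left[OF c0, of "\<Prod>b\<leftarrow>cs. [:- b, 1:]" G] less.hyps[of cs G] cs H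
        by (simp add: dG)
      also have "(\<Prod>c\<leftarrow>cs. poly G c) = (\<Prod>c\<leftarrow>cs. \<Prod>b\<leftarrow>bs. c - b)"
        unfolding G_def poly_prod_linear ..
      also have "\<dots> = (- 1) ^ (length bs * length cs) * (\<Prod>b\<leftarrow>bs. \<Prod>c\<leftarrow>cs. b - c)"
        by (rule prod_list_diff_swap)
      also have "(- 1) ^ (length bs * length cs) * (c ^ length bs * \<dots>)
          = (\<Prod>b\<leftarrow>bs. c * (\<Prod>c\<leftarrow>cs. b - c))"
        by (simp add: prod_list_map_mult prod_list_map_const mult_ac flip: power_mult_distrib)
      also have "\<dots> = (\<Prod>b\<leftarrow>bs. poly H b)"
        unfolding cs(1)[symmetric] poly_smult poly_prod_linear ..
      finally show ?thesis .
    qed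
    show ?thesis
    proof (cases "degree F < degree G")
      case True
      with small dG show ?thesis by (simp add: G_def)
    next
      case ge: False
      define H where "H = F mod G"
      have FH: "F + (- (F div G)) * G = H"
        by (simp add: H_def minus_mult_div_eq_mod algebra_simps)
      have dH: "degree H < degree G"
        using degree_mod_less[OF G0, of F] dpos by (auto simp: H_def)
      have FHb: "poly F b = poly H b" if "b \<in> set bs" for b
      proof -
        have "poly G b = 0"
          unfolding G_def poly_prod_linear using that by (auto simp: prod_list_zero_iff)
        then show ?thesis using arg_cong[OF FH, of "\<lambda>p. poly p b"] by simp
      qed
      have "resultant G F = resultant G H"
      proof -
        \<comment> \<open>The Euclidean step is read off from \<open>subresultant 0\<close>, whose
          identities are separate for zero, constant and non-constant \<open>H\<close>. Monic
          \<open>G\<close> removes the powers of its leading coefficient, and the sign cancels when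
          the arguments are swapped back.\<close>
        have "resultant F G = (- 1) ^ (degree F * degree G) * resultant G H"
        proof (cases "H = 0")
          case True
          have "F = (F div G) * G" using FH True by simp
          from subresultant_product[OF this, of 0] ge dpos
          have "subresultant 0 F G = 0" by simp
          then show ?thesis using True dpos by (simp add: subresultant_resultant)
        next
          case H0: False
          show ?thesis
          proof (cases "degree H = 0")
            case True
            then obtain c where c: "H = [:c:]" by (auto elim: degree_eq_zeroE)
            have "subresultant 0 F G = smult ((- 1) ^ (degree F * degree G) *
                lead_coeff G ^ degree F * lead_coeff H ^ (degree G - 1)) H"
              using BT_lemma_1_13[OF FH] ge dH True by simp
            then have "resultant F G = (- 1) ^ (degree F * degree G) * (c ^ (degree G - 1) * c)"
              by (simp add: subresultant_resultant c lG)
            also have "c ^ (degree G - 1) * c = c ^ degree G"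
              using dpos by (metis power_minus_mult)
            finally show ?thesis by (simp add: c)
          next
            case False
            have "subresultant 0 F G = smult ((- 1) ^ (degree F * degree G) *
                lead_coeff G ^ (degree F - degree H)) (subresultant 0 G H)"
              using BT_lemma_1_12[OF FH, of 0] ge dH False by simp
            then show ?thesis by (simp add: subresultant_resultant lG)
          qed
        qed
        then have "resultant G F = (- 1) ^ (degree F * degree G)
            * ((- 1) ^ (degree F * degree G) * resultant G H)"
          using resultant_swap[of G F] by (simp only: mult.commute[of "degree G"])
        then show ?thesis by (simp add: minus_one_power_iff)
      qed
      also have "\<dots> = (\<Prod>b\<leftarrow>bs. poly H b)" using small dH dG by simp
      also have "\<dots> = (\<Prod>b\<leftarrow>bs. poly F b)" using FHb by (metis map_eq_conv)
      finally show ?thesis by (simp add: G_def)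
    qed
  qed simp
qed

section \<open>Degree, derivative and resultant of \<open>fpoly n a\<close>\<close>

lemma degree_monic_power:
  assumes "lead_coeff (g :: int poly) = 1"
  shows "degree (g ^ k) = k * degree g" "lead_coeff (g ^ k) = 1"
proof -
  have "g \<noteq> 0" using assms by auto
  then show "degree (g ^ k) = k * degree g" by (rule Polynomial.degree_power_eq)
  show "lead_coeff (g ^ k) = 1" using assms by (simp add: lead_coeff_power)
qed

lemma fpoly_monic:
  assumes "n > 0"
  shows "degree (fpoly n a) = 2 * n" "lead_coeff (fpoly n a) = 1"
proof -
  have d: "degree ([:1, 0, 1 :: int:] ^ n) = 2 * n" "lead_coeff ([:1, 0, 1 :: int:] ^ n) = 1"
    using degree_monic_power[of "[:1, 0, 1:]" n] by simp_all
  have m: "degree (- monom a n) < degree ([:1, 0, 1 :: int:] ^ n)"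
    using degree_monom_le[of a n] assms d(1) by simp
  show "degree (fpoly n a) = 2 * n"
    using degree_add_eq_left[OF m] d(1) by (simp add: fpoly_def)
  have "coeff (monom a n) (2 * n) = 0" using assms by simp
  then show "lead_coeff (fpoly n a) = 1"
    using \<open>degree (fpoly n a) = 2 * n\<close> d by (simp add: fpoly_def)
qed

lemma ipoly_fpoly: "ipoly (fpoly n a) x = (x\<^sup>2 + 1) ^ n - of_int a * x ^ n"
  by (simp add: fpoly_def power2_eq_square add.commute)

text \<open>The factor \<open>x\<close> turns the \<open>a\<close>-term of \<open>f'\<close> into
  \<open>n a x^n\<close>, which \<open>f\<close> eliminates in favour of \<open>(x^2+1)^n\<close>.
  What remains is \<open>n (x^2+1)^(n-1)\<close> times
  \<open>2x^2 - (x^2+1) = -(1 - x^2)\<close>.\<close>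

lemma pderiv_fpoly:
  assumes "n > 0"
  shows "[:0, 1:] * pderiv (fpoly n a) =
    smult (int n) (fpoly n a - [:1, 0, 1:] ^ (n - 1) * [:1, 0, -1:])"
proof -
  obtain m where n: "n = Suc m" using assms gr0_implies_Suc by blast
  define X where "X = [:0, 1 :: int:]"
  have U: "[:1, 0, 1 :: int:] = 1 + X * X" "[:1, 0, -1 :: int:] = 1 - X * X"
    by (intro iffD1[OF poly_eq_poly_eq_iff] ext; simp add: X_def algebra_simps)+
  have dX: "pderiv X = 1" by (simp add: X_def pderiv_pCons)
  have dU: "pderiv (1 + X * X) = 2 * X"
    by (simp add: pderiv_add pderiv_mult dX)
  have f: "fpoly n a = (1 + X * X) ^ Suc m - smult a (X ^ Suc m)"
    unfolding fpoly_def U n monom_altdef X_def ..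
  have alg: "X * (N * (w * (2 * X)) - smult a (N * v)) =
      N * ((1 + X * X) * w - smult a (X * v) - w * (1 - X * X))" for N v w
    by (simp add: algebra_simps)
  have "pderiv (fpoly n a) = of_nat n * ((1 + X * X) ^ m * (2 * X)) - smult a (of_nat n * X ^ m)"
    unfolding f pderiv_diff pderiv_power_Suc pderiv_smult dU dX by (simp add: n of_nat_poly)
  then have "X * pderiv (fpoly n a) = of_nat n * (fpoly n a - (1 + X * X) ^ m * (1 - X * X))"
    unfolding f using alg by simp
  moreover have "of_nat n * g = smult (int n) g" for g :: "int poly"
    by (simp add: of_nat_poly)
  ultimately show ?thesis
    unfolding U unfolding X_def[symmetric] by (simp only: n diff_Suc_1)
qed

text \<open>Over the roots \<alpha>, each factor of \<open>\<alpha> f'(\<alpha>)\<close> multiplies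
  up to values of \<open>f\<close>: the product of \<alpha> is \<open>f(0) = 1\<close>, that of
  \<open>\<alpha>^2 + 1\<close> is \<open>f(\<i>) f(-\<i>) = a^2\<close>, and that of
  \<open>1 - \<alpha>^2\<close> is \<open>f(1) f(-1)\<close>. Signs vanish because there are
  \<open>2n\<close> roots.\<close>

lemma resultant_fpoly:
  assumes n: "n > 0"
  shows "resultant (fpoly n a) (pderiv (fpoly n a)) =
    int n ^ (2 * n) * (a\<^sup>2) ^ (n - 1) * ((2 ^ n - a) * (2 ^ n - (- 1) ^ n * a))"
proof -
  define f where "f = fpoly n a"
  define F :: "complex poly" where "F = map_poly of_int f"
  have deg: "degree f = 2 * n" and lc: "lead_coeff f = 1" using fpoly_monic[OF n] by (simp_all add: f_def)
  have "lead_coeff F = 1" using lc by (simp add: F_def)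
  moreover obtain as where "smult (lead_coeff F) (\<Prod>a\<leftarrow>as. [:- a, 1:]) = F" "length as = degree F"
    using fundamental_theorem_algebra_factorized[of F] by blast
  ultimately have as: "F = (\<Prod>a\<leftarrow>as. [:- a, 1:])" "length as = 2 * n"
    using deg by (simp_all add: F_def)
  have Fx: "(\<Prod>\<alpha>\<leftarrow>as. x - \<alpha>) = (x\<^sup>2 + 1) ^ n - of_int a * x ^ n" for x
  proof -
    have "poly F x = (x\<^sup>2 + 1) ^ n - of_int a * x ^ n"
      unfolding F_def f_def ipoly_fpoly[symmetric] ipoly_def ..
    then show ?thesis unfolding as(1) poly_prod_linear .
  qed
  have neg: "(\<Prod>\<alpha>\<leftarrow>as. (- 1 :: complex)) = 1"
    by (simp add: prod_list_map_const as(2) power_mult)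
  have "(\<Prod>\<alpha>\<leftarrow>as. \<alpha>) = (\<Prod>\<alpha>\<leftarrow>as. (- 1) * (0 - \<alpha>))" by simp
  also have "\<dots> = 1" unfolding prod_list_map_mult neg Fx using n by simp
  finally have P0: "(\<Prod>\<alpha>\<leftarrow>as. \<alpha>) = 1" .
  have ii: "(\<i>\<^sup>2 + 1 :: complex) ^ n = 0" "((- \<i>)\<^sup>2 + 1 :: complex) ^ n = 0" using n by simp_all
  have "(\<Prod>\<alpha>\<leftarrow>as. \<alpha>\<^sup>2 + 1) = (\<Prod>\<alpha>\<leftarrow>as. (\<i> - \<alpha>) * (- \<i> - \<alpha>))"
    by (simp add: algebra_simps power2_eq_square)
  also have "\<dots> = of_int (a\<^sup>2) * (\<i> * - \<i>) ^ n"
    unfolding prod_list_map_mult Fx ii power_mult_distrib by (simp add: power2_eq_square)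
  also have "\<i> * - \<i> = 1" by simp
  finally have Pi: "(\<Prod>\<alpha>\<leftarrow>as. \<alpha>\<^sup>2 + 1) = of_int (a\<^sup>2)" by simp
  have "(\<Prod>\<alpha>\<leftarrow>as. 1 - \<alpha>\<^sup>2) = (\<Prod>\<alpha>\<leftarrow>as. (- 1) * ((1 - \<alpha>) * (- 1 - \<alpha>)))"
    by (simp add: algebra_simps power2_eq_square)
  also have "\<dots> = of_int ((2 ^ n - a) * (2 ^ n - (- 1) ^ n * a))"
    unfolding prod_list_map_mult Fx neg by simp
  finally have P1: "(\<Prod>\<alpha>\<leftarrow>as. 1 - \<alpha>\<^sup>2) = of_int ((2 ^ n - a) * (2 ^ n - (- 1) ^ n * a))" .
  have pd: "\<alpha> * poly (pderiv F) \<alpha> = (- of_nat n) * ((\<alpha>\<^sup>2 + 1) ^ (n - 1) * (1 - \<alpha>\<^sup>2))"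
    if "\<alpha> \<in> set as" for \<alpha>
  proof -
    have "poly F \<alpha> = 0" unfolding as(1) poly_prod_linear using that
      by (auto simp: prod_list_zero_iff)
    then have r: "ipoly f \<alpha> = 0" by (simp add: F_def ipoly_def)
    have "poly (pderiv F) \<alpha> = ipoly (pderiv f) \<alpha>"
      by (simp add: F_def ipoly_def of_int_hom.map_poly_pderiv)
    then show ?thesis
      using arg_cong[OF pderiv_fpoly[OF n, of a], of "\<lambda>g. ipoly g \<alpha>"] r
      by (simp add: f_def[symmetric] power2_eq_square algebra_simps)
  qed
  have "of_int (resultant f (pderiv f)) = resultant F (pderiv F)"
    unfolding F_def of_int_hom.map_poly_pderiv[symmetric] by (simp add: of_int_hom.resultant_hom)
  \<comment> \<open>The inserted product of the roots is 1; it supplies the factor \<open>x\<close>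
    of \<open>pderiv_fpoly\<close>.\<close>
  also have "\<dots> = (\<Prod>\<alpha>\<leftarrow>as. \<alpha>) * (\<Prod>\<alpha>\<leftarrow>as. poly (pderiv F) \<alpha>)"
    using resultant_prod_linear[of as "pderiv F"] unfolding as(1)[symmetric] P0 by simp
  also have "\<dots> = (\<Prod>\<alpha>\<leftarrow>as. \<alpha> * poly (pderiv F) \<alpha>)" by (rule prod_list_map_mult[symmetric])
  also have "\<dots> = (\<Prod>\<alpha>\<leftarrow>as. (- of_nat n) * ((\<alpha>\<^sup>2 + 1) ^ (n - 1) * (1 - \<alpha>\<^sup>2)))"
    using pd by (metis (no_types, lifting) map_eq_conv)
  also have "\<dots> = (- of_nat n) ^ (2 * n) * (of_int (a\<^sup>2) ^ (n - 1)
      * of_int ((2 ^ n - a) * (2 ^ n - (- 1) ^ n * a)))"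
    by (simp only: prod_list_map_mult prod_list_map_const prod_list_map_power as(2) Pi P1)
  also have "\<dots> = of_int (int n ^ (2 * n) * (a\<^sup>2) ^ (n - 1)
      * ((2 ^ n - a) * (2 ^ n - (- 1) ^ n * a)))"
    by (simp add: power_mult)
  finally show ?thesis unfolding f_def of_int_eq_iff .
qed

section \<open>The four cases\<close>

text \<open>Membership in the square of the ideal \<open>(p, \<pi>)\<close>, written out on the
  products of its generators.\<close>

definition mod_sq :: "int \<Rightarrow> int poly \<Rightarrow> int poly \<Rightarrow> bool" where
  "mod_sq p \<pi> g \<longleftrightarrow> (\<exists>s t u. g = \<pi>\<^sup>2 * s + smult p (\<pi> * t) + smult (p\<^sup>2) u)"

lemma mod_sq_diff: "mod_sq p \<pi> g \<Longrightarrow> mod_sq p \<pi> h \<Longrightarrow> mod_sq p \<pi> (g - h)"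
proof -
  assume "mod_sq p \<pi> g" "mod_sq p \<pi> h"
  then obtain s t u s' t' u' where
    "g = \<pi>\<^sup>2 * s + smult p (\<pi> * t) + smult (p\<^sup>2) u"
    "h = \<pi>\<^sup>2 * s' + smult p (\<pi> * t') + smult (p\<^sup>2) u'"
    unfolding mod_sq_def by blast
  then have "g - h = \<pi>\<^sup>2 * (s - s') + smult p (\<pi> * (t - t')) + smult (p\<^sup>2) (u - u')"
    by (simp add: algebra_simps smult_diff_right)
  then show ?thesis unfolding mod_sq_def by blast
qed

lemma mod_sq_mult:
  assumes "mod_dvd p \<pi> g" "mod_dvd p \<pi> h"
  shows "mod_sq p \<pi> (g * h)"
proof -
  obtain a b c d where "g = a * \<pi> + smult p b" "h = c * \<pi> + smult p d"
    using assms unfolding mod_dvd_def by blast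
  then have "g * h = \<pi>\<^sup>2 * (a * c) + smult p (\<pi> * (a * d + b * c)) + smult (p\<^sup>2) (b * d)"
    by (simp add: algebra_simps smult_add_right power2_eq_square)
  then show ?thesis unfolding mod_sq_def by blast
qed

lemma mod_sq_power:
  assumes "mod_dvd p \<pi> g" "k \<ge> 2"
  shows "mod_sq p \<pi> (g ^ k)"
proof -
  obtain l where "k = Suc (Suc l)" using assms(2) by (metis add_2_eq_Suc le_Suc_ex)
  then show ?thesis
    using mod_sq_mult[OF assms(1) mod_dvd_mult2[OF assms(1), of "g ^ l"]] by simp
qed

lemma mod_sq_imp_mod_dvd: "mod_sq p \<pi> g \<Longrightarrow> mod_dvd p \<pi> g"
proof -
  assume "mod_sq p \<pi> g"
  then obtain s t u where "g = \<pi>\<^sup>2 * s + smult p (\<pi> * t) + smult (p\<^sup>2) u"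
    unfolding mod_sq_def by blast
  then have "g = (\<pi> * s) * \<pi> + smult p (\<pi> * t + smult p u)"
    by (simp add: power2_eq_square smult_add_right mult_ac)
  then show ?thesis unfolding mod_dvd_def by blast
qed

text \<open>A monic polynomial is not a zero divisor modulo \<open>p\<close>: with \<open>q\<close>
  the quotient of \<open>h\<close> by \<open>m\<close>, the product
  \<open>m * (s - smult p q)\<close> has degree below \<open>m\<close>, so its second factor is
  zero.\<close>

lemma monic_mult_eq_smult:
  fixes m :: "int poly"
  assumes m: "lead_coeff m = 1" and eq: "m * s = smult p h"
  shows "\<exists>q. s = smult p q"
proof -
  obtain q r where qr: "h = q * m + r" "r = 0 \<or> degree r < degree m"
    using monic_division[OF m] by blast
  have m0: "m \<noteq> 0" using m by auto
  have e: "m * (s - smult p q) = smult p r"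
    using eq qr(1) by (simp add: algebra_simps smult_add_right)
  have "s - smult p q = 0"
  proof (rule ccontr)
    assume n0: "s - smult p q \<noteq> 0"
    then have "degree (smult p r) \<ge> degree m"
      unfolding e[symmetric] using degree_mult_eq[OF m0 n0] by simp
    moreover have "r \<noteq> 0" using e n0 m0 by auto
    ultimately show False using qr(2) degree_smult_le[of p r] by simp
  qed
  then show ?thesis by auto
qed

text \<open>Modulo \<open>p\<close> only the term with \<pi> squared survives, so its cofactor is
  divisible by \<open>p\<close>; then \<open>p\<close> cancels throughout.\<close>

lemma mod_sq_smult:
  assumes p: "p \<noteq> 0" and \<pi>: "lead_coeff \<pi> = 1" and sq: "mod_sq p \<pi> (smult p g)"
  shows "mod_dvd p \<pi> g"
proof -
  obtain s t u where e: "smult p g = \<pi>\<^sup>2 * s + smult p (\<pi> * t) + smult (p\<^sup>2) u"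
    using sq unfolding mod_sq_def by blast
  then have "\<pi>\<^sup>2 * s = smult p (g - \<pi> * t - smult p u)"
    by (simp add: smult_diff_right power2_eq_square)
  moreover have "lead_coeff (\<pi>\<^sup>2) = 1" using degree_monic_power[OF \<pi>] by blast
  ultimately obtain q where q: "s = smult p q" using monic_mult_eq_smult by blast
  have "smult p g = smult p ((\<pi> * q + t) * \<pi> + smult p u)"
    unfolding e q by (simp add: smult_add_right power2_eq_square algebra_simps)
  then have "g = (\<pi> * q + t) * \<pi> + smult p u"
    using p smult_eq_0_iff[of p "g - ((\<pi> * q + t) * \<pi> + smult p u)"]
    by (simp only: smult_diff_right) simp
  then show ?thesis unfolding mod_dvd_def by blast
qed

lemma mod_dvd_smult_cancel:
  assumes p: "prime p" and c: "\<not> p dvd c" and dvd: "mod_dvd p \<pi> (smult c g)"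
  shows "mod_dvd p \<pi> g"
proof -
  have "coprime p c" using p c by (simp add: prime_imp_coprime)
  then obtain u v where uv: "u * p + v * c = 1" using bezout_int[of p c] by auto
  have "g = smult (u * p + v * c) g" using uv by simp
  also have "\<dots> = smult p (smult u g) + [:v:] * smult c g"
    by (simp add: smult_add_left mult.commute)
  also have "mod_dvd p \<pi> \<dots>" by (intro mod_dvd_add mod_dvd_smult mod_dvd_mult dvd)
  finally show ?thesis .
qed

text \<open>Constant coefficient 1 makes \<open>X\<close> a unit modulo \<open>f\<close>, so
  \<open>X\<close> stays outside the prime ideal \<open>(p, \<pi>)\<close> and only \<open>p\<close>
  dividing \<open>c\<close> is left.\<close>

lemma mod_dvd_X_power_coeff:
  assumes p: "prime p" and \<pi>: "mod_prime p \<pi>" and f: "mod_dvd p \<pi> f" "coeff f 0 = 1"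
    and dvd: "mod_dvd p \<pi> (smult c ([:0, 1:] ^ k))"
  shows "p dvd c"
proof (rule ccontr)
  assume "\<not> p dvd c"
  then have "mod_dvd p \<pi> ([:0, 1:] ^ k)" using mod_dvd_smult_cancel[OF p] dvd by blast
  then have X: "mod_dvd p \<pi> [:0, 1:]" using mod_prime_power[OF prime_gt_1_int[OF p] \<pi>] by blast
  obtain c g where cg: "f = pCons c g" by (cases f)
  then have "c = 1" using f(2) by simp
  with cg have "1 = f - g * [:0, 1:]" by simp
  moreover have "mod_dvd p \<pi> (f - g * [:0, 1:])" by (intro mod_dvd_diff f mod_dvd_mult X)
  ultimately show False using mod_prime_not_1[OF prime_gt_1_int[OF p] \<pi>] by simp
qed

lemma mod_dvd_pderiv:
  assumes "mod_sq p \<pi> f"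
  shows "mod_dvd p \<pi> (pderiv f)"
proof -
  obtain s t u where f: "f = \<pi>\<^sup>2 * s + smult p (\<pi> * t) + smult (p\<^sup>2) u"
    using assms unfolding mod_sq_def by blast
  have "pderiv f = (2 * pderiv \<pi> * s + \<pi> * pderiv s) * \<pi>
      + smult p (pderiv (\<pi> * t) + smult p (pderiv u))"
    unfolding f by (simp add: pderiv_add pderiv_smult pderiv_mult power2_eq_square
        smult_add_right algebra_simps)
  then show ?thesis unfolding mod_dvd_def by blast
qed

text \<open>By degree, \<pi> is \<open>X - e\<close> up to a multiple of \<open>p\<close>. Hence
  \<open>p\<close> divides \<open>\<pi>(e)\<close>, and every generator of the square is divisible
  by \<open>p^2\<close> at \<open>e\<close>.\<close>

lemma mod_sq_linear_root:
  assumes p: "p > 1" and \<pi>: "mod_prime p \<pi>" and lin: "mod_dvd p \<pi> [:- e, 1:]" and sq: "mod_sq p \<pi> f"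
  shows "p\<^sup>2 dvd poly f e"
proof -
  have l1: "lead_coeff \<pi> = 1" "degree \<pi> > 0" using \<pi> unfolding mod_prime_def by blast+
  have l2: "lead_coeff [:- e, 1:] = 1" by simp
  obtain q r where qr: "[:- e, 1:] = q * \<pi> + smult p r" "lead_coeff q = 1"
    "degree [:- e, 1:] = degree q + degree \<pi>"
    using mod_dvd_monic[OF p l1(1) l2 lin] by blast
  have "degree q = 0" using qr(3) l1(2) by simp
  then have "q = 1" using qr(2) monic_degree_0 by blast
  then have "\<pi> = [:- e, 1:] - smult p r" using qr(1) by simp
  then have "poly \<pi> e = - p * poly r e" by simp
  moreover obtain s t u where "f = \<pi>\<^sup>2 * s + smult p (\<pi> * t) + smult (p\<^sup>2) u"
    using sq unfolding mod_sq_def by blast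
  ultimately have "poly f e = p\<^sup>2 * ((poly r e)\<^sup>2 * poly s e - poly r e * poly t e + poly u e)"
    by (simp add: algebra_simps power2_eq_square)
  then show ?thesis by simp
qed

text \<open>The mixed binomial terms are divisible by \<open>p\<close> and contain \<open>x\<close>.
  The error is kept as a multiple of \<open>p * x\<close>, not merely of \<open>p\<close>, because
  with \<open>x\<close> in \<open>(p, \<pi>)\<close> this places it in
  \<open>(p, \<pi>)^2\<close>.\<close>

lemma power_prime_add:
  fixes x y :: "'a :: comm_ring_1"
  assumes p: "prime p"
  shows "\<exists>t. (x + y) ^ p = x ^ p + y ^ p + of_nat p * x * t"
proof -
  define T where "T = (\<Sum>k\<in>{1..<p}. of_nat ((p choose k) div p) * x ^ (k - 1) * y ^ (p - k))"
  have p0: "p > 0" using prime_gt_0_nat[OF p] .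
  have split: "{..p} = insert 0 (insert p {1..<p})" using p0 by auto
  have "(x + y) ^ p = (\<Sum>k\<le>p. of_nat (p choose k) * x ^ k * y ^ (p - k))"
    by (rule binomial_ring)
  also have "\<dots> = y ^ p + (x ^ p + (\<Sum>k\<in>{1..<p}. of_nat (p choose k) * x ^ k * y ^ (p - k)))"
    unfolding split using p0 by simp
  also have "(\<Sum>k\<in>{1..<p}. of_nat (p choose k) * x ^ k * y ^ (p - k)) = of_nat p * x * T"
    unfolding T_def sum_distrib_left
  proof (rule sum.cong)
    fix k assume k: "k \<in> {1..<p}"
    then have "p dvd (p choose k)" using p by (intro dvd_choose_prime) auto
    then have c: "of_nat (p choose k) = of_nat p * (of_nat ((p choose k) div p) :: 'a)"
      by (metis dvd_mult_div_cancel of_nat_mult)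
    have "x ^ k = x * x ^ (k - 1)" using k by (metis Suc_le_eq atLeastLessThan_iff power_minus_mult One_nat_def mult.commute)
    then show "of_nat (p choose k) * x ^ k * y ^ (p - k) =
        of_nat p * x * (of_nat ((p choose k) div p) * x ^ (k - 1) * y ^ (p - k))"
      unfolding c by (simp only: mult_ac)
  qed simp
  finally show ?thesis by (intro exI[of _ T]) (simp add: add_ac)
qed

text \<open>The shape of the error survives another \<open>p\<close>-th power: the terms from
  \<open>?b\<close> inherit the factor \<open>p * x\<close>, and the new mixed term has
  \<open>p * x ^ ?q\<close> with \<open>?q > 0\<close>.\<close>

lemma power_prime_power_add:
  fixes x y :: "'a :: comm_ring_1"
  assumes p: "prime p"
  shows "\<exists>t. (x + y) ^ (p ^ j) = x ^ (p ^ j) + y ^ (p ^ j) + of_nat p * x * t"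
proof (induction j)
  case 0
  show ?case by (rule exI[of _ 0]) simp
next
  case (Suc j)
  then obtain t where t: "(x + y) ^ (p ^ j) = x ^ (p ^ j) + y ^ (p ^ j) + of_nat p * x * t" by blast
  let ?q = "p ^ j"
  obtain q' where q': "?q = Suc q'" using prime_gt_0_nat[OF p] by (metis gr0_implies_Suc zero_less_power)
  obtain p' where p': "p = Suc p'" using prime_gt_0_nat[OF p] gr0_implies_Suc by blast
  let ?b = "of_nat p * x * t"
  obtain t1 where t1: "(?b + (x ^ ?q + y ^ ?q)) ^ p = ?b ^ p + (x ^ ?q + y ^ ?q) ^ p + of_nat p * ?b * t1"
    using power_prime_add[OF p] by blast
  obtain t2 where t2: "(x ^ ?q + y ^ ?q) ^ p = (x ^ ?q) ^ p + (y ^ ?q) ^ p + of_nat p * x ^ ?q * t2"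
    using power_prime_add[OF p] by blast
  have b: "?b ^ p = of_nat p * x * (t * ?b ^ p')"
    by (subst p', simp only: power_Suc mult_ac)
  have xq: "x ^ ?q = x * x ^ q'" unfolding q' by simp
  have "(x + y) ^ (p ^ Suc j) = (?b + (x ^ ?q + y ^ ?q)) ^ p"
  proof -
    have "(x + y) ^ (p ^ Suc j) = ((x + y) ^ ?q) ^ p" by (simp add: mult.commute flip: power_mult)
    also have "(x + y) ^ ?q = ?b + (x ^ ?q + y ^ ?q)" unfolding t by (simp only: add_ac)
    finally show ?thesis .
  qed
  also have "\<dots> = (x ^ ?q) ^ p + (y ^ ?q) ^ p
      + of_nat p * x * (t * ?b ^ p' + x ^ q' * t2 + of_nat p * t * t1)"
    unfolding t1 t2 b unfolding xq by (simp only: algebra_simps)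
  also have "(x ^ ?q) ^ p = x ^ (p ^ Suc j)" by (simp add: mult.commute flip: power_mult)
  also have "(y ^ ?q) ^ p = y ^ (p ^ Suc j)" by (simp add: mult.commute flip: power_mult)
  finally show ?case by blast
qed

text \<open>Fermat's little theorem, itself a consequence of \<open>power_prime_add\<close>,
  telescoped over \<open>j\<close>.\<close>

lemma prime_dvd_power_diff_self:
  fixes a :: int
  assumes p: "prime p"
  shows "int p dvd a ^ (p ^ j) - a"
proof (induction j)
  case (Suc j)
  have fermat: "int p dvd b ^ p - b" for b :: int
  proof (induction b rule: int_induct[of _ 0])
    case base
    show ?case using prime_gt_0_nat[OF p] by (simp add: zero_power)
  next
    case (step1 i)
    obtain t where "(i + 1) ^ p = i ^ p + 1 ^ p + of_nat p * i * t" using power_prime_add[OF p] by blast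
    then have "(i + 1) ^ p - (i + 1) = (i ^ p - i) + int p * (i * t)" by (simp add: mult_ac)
    then show ?case using step1 by (simp only: dvd_add dvd_triv_left)
  next
    case (step2 i)
    obtain t where t: "((i - 1) + 1) ^ p = (i - 1) ^ p + 1 ^ p + of_nat p * (i - 1) * t"
      using power_prime_add[OF p] by blast
    then have "(i - 1) ^ p - (i - 1) = (i ^ p - i) - int p * ((i - 1) * t)" by (simp add: mult_ac)
    then show ?case using step2 by (simp only: dvd_diff dvd_triv_left)
  qed
  have "a ^ (p ^ Suc j) - a = ((a ^ (p ^ j)) ^ p - a ^ (p ^ j)) + (a ^ (p ^ j) - a)"
    by (simp add: mult.commute flip: power_mult)
  then show ?case using fermat[of "a ^ (p ^ j)"] Suc by (simp only: dvd_add)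
qed simp

lemma fpoly_X: "fpoly n a = [:1, 0, 1:] ^ n - smult a ([:0, 1:] ^ n)"
  by (simp add: fpoly_def monom_altdef)

lemma coeff_fpoly_0: "n > 0 \<Longrightarrow> coeff (fpoly n a) 0 = 1"
  by (simp add: poly_0_coeff_0[symmetric] fpoly_X)

lemma poly_fpoly: "poly (fpoly n a) x = (1 + x\<^sup>2) ^ n - a * x ^ n"
  by (simp add: fpoly_X power2_eq_square)

text \<open>Raise \<open>(x^2+1)^m = w + a x^m\<close>, with \<open>w = fpoly m a\<close>, to the
  power \<open>p^j\<close>: the left side becomes \<open>fpoly n a + a x^n\<close>, and the right
  side produces \<open>w^(p^j)\<close>, the mixed error and \<open>a^(p^j) x^n\<close>.\<close>

lemma fpoly_prime_power_decomposition:
  assumes p: "prime p" and n: "n = p ^ j * m"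
  obtains S where "fpoly n a = fpoly m a ^ (p ^ j) + smult (int p) (fpoly m a * S)
    + smult (a ^ (p ^ j) - a) ([:0, 1:] ^ n)"
proof -
  define q where "q = p ^ j"
  define w where "w = fpoly m a"
  define v where "v = smult a ([:0, 1 :: int:] ^ m)"
  obtain S where S: "(w + v) ^ q = w ^ q + v ^ q + of_nat p * w * S"
    unfolding q_def using power_prime_power_add[OF p] by blast
  have wv: "w + v = [:1, 0, 1:] ^ m" by (simp add: w_def v_def fpoly_X)
  have "fpoly n a = (w + v) ^ q - smult a ([:0, 1:] ^ n)"
    unfolding wv fpoly_X n q_def by (simp only: power_mult[symmetric] mult.commute)
  also have "v ^ q = smult (a ^ q) ([:0, 1:] ^ n)"
    unfolding v_def smult_power n q_def by (simp only: power_mult[symmetric] mult.commute)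
  then have "(w + v) ^ q - smult a ([:0, 1:] ^ n)
      = w ^ q + smult (int p) (w * S) + smult (a ^ q - a) ([:0, 1:] ^ n)"
  proof -
    have "of_nat p * w * S = smult (int p) (w * S)" by (simp add: of_nat_poly)
    with \<open>v ^ q = _\<close> show ?thesis unfolding S by (simp add: smult_diff_left)
  qed
  finally show ?thesis unfolding q_def w_def by (rule that)
qed

section \<open>The index of \<open>fpoly n a\<close> at a fixed prime\<close>

locale fpoly_root = monic_irreducible "fpoly n a" \<theta> for n :: nat and a :: int and \<theta> :: complex +
  fixes p :: nat
  assumes n2: "n \<ge> 2" and p: "prime p"
begin

lemma prime_p: "prime (int p)" and p1: "int p > 1" and n0: "n > 0"
  using p prime_gt_1_nat[OF p] n2 by auto

lemma index_imp:
  assumes "p dvd order_index \<theta>"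
  obtains \<pi> where "mod_prime (int p) \<pi>" "mod_sq (int p) \<pi> (fpoly n a)" "mod_dvd (int p) \<pi> (fpoly n a)"
    "lead_coeff \<pi> = 1"
proof -
  obtain \<pi> s t u where pi: "mod_prime (int p) \<pi>"
    "fpoly n a = \<pi>\<^sup>2 * s + smult (int p) (\<pi> * t) + smult ((int p)\<^sup>2) u"
    using prime_dvd_index_imp[OF p assms] by blast
  then have "mod_sq (int p) \<pi> (fpoly n a)" unfolding mod_sq_def by blast
  then show thesis using that pi(1) mod_sq_imp_mod_dvd unfolding mod_prime_def by blast
qed

lemma X_power_coeff:
  assumes "mod_prime (int p) \<pi>" "mod_dvd (int p) \<pi> (fpoly n a)"
    "mod_dvd (int p) \<pi> (smult c ([:0, 1:] ^ n))"
  shows "int p dvd c"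
  using mod_dvd_X_power_coeff[OF prime_p assms(1,2) coeff_fpoly_0[OF n0] assms(3)] .

lemma index_iff_dvd_a:
  assumes pa: "int p dvd a"
  shows "p dvd order_index \<theta> \<longleftrightarrow> (int p)\<^sup>2 dvd a"
proof
  assume "p dvd order_index \<theta>"
  then obtain \<pi> where \<pi>: "mod_prime (int p) \<pi>" "mod_sq (int p) \<pi> (fpoly n a)"
    "mod_dvd (int p) \<pi> (fpoly n a)" "lead_coeff \<pi> = 1" by (rule index_imp)
  obtain c where c: "a = int p * c" using pa by auto
  have e: "smult (int p) (smult c ([:0, 1:] ^ n)) = [:1, 0, 1:] ^ n - fpoly n a"
    by (simp add: fpoly_X c)
  have "mod_dvd (int p) \<pi> (fpoly n a + smult (int p) (smult c ([:0, 1:] ^ n)))"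
    by (intro mod_dvd_add \<pi> mod_dvd_smult)
  then have "mod_dvd (int p) \<pi> ([:1, 0, 1:] ^ n)" unfolding e by simp
  then have "mod_dvd (int p) \<pi> [:1, 0, 1:]" by (rule mod_prime_power[OF p1 \<pi>(1)])
  then have "mod_sq (int p) \<pi> (smult (int p) (smult c ([:0, 1:] ^ n)))"
    unfolding e by (intro mod_sq_diff mod_sq_power \<pi> n2)
  then have "mod_dvd (int p) \<pi> (smult c ([:0, 1:] ^ n))"
    using mod_sq_smult[OF _ \<pi>(4)] p1 by auto
  then have "int p dvd c" by (rule X_power_coeff[OF \<pi>(1,3)])
  then show "(int p)\<^sup>2 dvd a" unfolding c power2_eq_square by (rule mult_dvd_mono[OF dvd_refl])
next
  assume "(int p)\<^sup>2 dvd a"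
  then obtain c where c: "a = (int p)\<^sup>2 * c" by auto
  define U where "U = [:1, 0, 1 :: int:]"
  have U: "lead_coeff U = 1" "degree U = 2" by (simp_all add: U_def)
  have e: "U * U ^ (n - 2) = U ^ (n - 1)" "U\<^sup>2 * U ^ (n - 2) = U ^ n"
    using n2 by (simp_all flip: power_Suc power_add add: Suc_diff_Suc numeral_2_eq_2)
  \<comment> \<open>\<open>prime_dvd_index\<close> accepts any \<pi> for which
    \<open>\<pi> * s\<close> is monic of degree below \<open>f\<close>, so \<open>x^2 + 1\<close>
    itself serves, even where it splits modulo \<open>p\<close>.\<close>
  have "fpoly n a = U\<^sup>2 * U ^ (n - 2) + smult (int p) (U * 0)
      + smult ((int p)\<^sup>2) (- smult c ([:0, 1:] ^ n))"
    unfolding e by (simp add: fpoly_X U_def c)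
  then show "p dvd order_index \<theta>"
  proof (rule prime_dvd_index[OF p])
    show "lead_coeff (U * U ^ (n - 2)) = 1" unfolding e by (rule degree_monic_power[OF U(1)])
    show "degree (U * U ^ (n - 2)) < degree (fpoly n a)"
      unfolding e degree_monic_power[OF U(1)] fpoly_monic[OF n0] U(2) using n2 by simp
  qed
qed

lemma index_iff_dvd_n:
  assumes pn: "p dvd n"
  defines "q \<equiv> p ^ multiplicity p n"
  shows "p dvd order_index \<theta> \<longleftrightarrow> (int p)\<^sup>2 dvd a ^ q - a"
proof -
  obtain m where m: "n = p ^ multiplicity p n * m" using multiplicity_dvd by (metis dvd_def)
  obtain S where S: "fpoly n a = fpoly m a ^ q + smult (int p) (fpoly m a * S)
      + smult (a ^ q - a) ([:0, 1:] ^ n)"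
    unfolding q_def using fpoly_prime_power_decomposition[OF p m] by blast
  have m0: "m > 0" using m n0 by (cases m) auto
  have "multiplicity p n > 0"
    using pn n0 p by (intro prime_multiplicity_gt_zero_iff[THEN iffD2]) auto
  then have "p \<le> q" unfolding q_def using prime_gt_0_nat[OF p] by (cases "multiplicity p n") auto
  then have q2: "q \<ge> 2" using prime_ge_2_nat[OF p] by simp
  define w where "w = fpoly m a"
  show ?thesis
  proof
    assume "p dvd order_index \<theta>"
    then obtain \<pi> where \<pi>: "mod_prime (int p) \<pi>" "mod_sq (int p) \<pi> (fpoly n a)"
      "mod_dvd (int p) \<pi> (fpoly n a)" "lead_coeff \<pi> = 1" by (rule index_imp)
    obtain c where c: "a ^ q - a = int p * c"
      using prime_dvd_power_diff_self[OF p, of a "multiplicity p n"] unfolding q_def by (rule dvdE)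
    have e: "smult (int p) (smult c ([:0, 1:] ^ n)) = fpoly n a - w ^ q - smult (int p) (w * S)"
      unfolding S c w_def by simp
    have "w ^ q = fpoly n a - smult (int p) (w * S + smult c ([:0, 1:] ^ n))"
      unfolding S c w_def by (simp add: smult_add_right)
    also have "mod_dvd (int p) \<pi> \<dots>" by (intro mod_dvd_diff \<pi> mod_dvd_smult)
    finally have w: "mod_dvd (int p) \<pi> w" by (rule mod_prime_power[OF p1 \<pi>(1)])
    \<comment> \<open>Now that \<open>w\<close> is in \<open>(p, \<pi>)\<close>, both
      \<open>w^q\<close> and the mixed term lie in the square, which isolates the term
      \<open>p c x^n\<close>.\<close>
    have "mod_sq (int p) \<pi> (w * smult (int p) S)" by (intro mod_sq_mult w mod_dvd_smult)
    then have "mod_sq (int p) \<pi> (smult (int p) (smult c ([:0, 1:] ^ n)))"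
      unfolding e by (intro mod_sq_diff mod_sq_power \<pi> q2 w) simp
    then have "mod_dvd (int p) \<pi> (smult c ([:0, 1:] ^ n))"
      using mod_sq_smult[OF _ \<pi>(4)] p1 by auto
    then have "int p dvd c" by (rule X_power_coeff[OF \<pi>(1,3)])
    then show "(int p)\<^sup>2 dvd a ^ q - a"
      unfolding c power2_eq_square by (rule mult_dvd_mono[OF dvd_refl])
  next
    assume "(int p)\<^sup>2 dvd a ^ q - a"
    then obtain c where c: "a ^ q - a = (int p)\<^sup>2 * c" by (rule dvdE)
    have W: "lead_coeff w = 1" "degree w = 2 * m" unfolding w_def using fpoly_monic[OF m0] by blast+
    have e: "w * w ^ (q - 2) = w ^ (q - 1)" "w\<^sup>2 * w ^ (q - 2) = w ^ q"
      using q2 by (simp_all flip: power_Suc power_add add: Suc_diff_Suc numeral_2_eq_2)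
    have "fpoly n a = w\<^sup>2 * w ^ (q - 2) + smult (int p) (w * S)
        + smult ((int p)\<^sup>2) (smult c ([:0, 1:] ^ n))"
      unfolding e unfolding S c w_def by simp
    then show "p dvd order_index \<theta>"
    proof (rule prime_dvd_index[OF p])
      show "lead_coeff (w * w ^ (q - 2)) = 1" unfolding e by (rule degree_monic_power[OF W(1)])
      have "(q - 1) * m < q * m" using m0 q2 by simp
      then show "degree (w * w ^ (q - 2)) < degree (fpoly n a)"
        unfolding e degree_monic_power[OF W(1)] fpoly_monic[OF n0] W(2)
        using m by (simp add: q_def mult.left_commute)
    qed
  qed
qed

text \<open>\<pi> divides \<open>f\<close> and \<open>f'\<close> modulo \<open>p\<close>, hence
  \<open>(x^2+1)^(n-1) (1-x^2)\<close> since \<open>n\<close> is invertible. A divisor of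
  \<open>x^2+1\<close> and \<open>f\<close> would divide \<open>a x^n\<close>, which is impossible
  for \<open>a\<close> prime to \<open>p\<close>; so \<pi> divides \<open>x - 1\<close> or
  \<open>x + 1\<close>.\<close>

lemma index_imp_root:
  assumes "\<not> int p dvd a" "\<not> p dvd n" "p dvd order_index \<theta>"
  shows "(int p)\<^sup>2 dvd 2 ^ n - a \<or> (int p)\<^sup>2 dvd 2 ^ n - (- 1) ^ n * a"
proof -
  obtain \<pi> where \<pi>: "mod_prime (int p) \<pi>" "mod_sq (int p) \<pi> (fpoly n a)"
    "mod_dvd (int p) \<pi> (fpoly n a)" "lead_coeff \<pi> = 1" using index_imp[OF assms(3)] by blast
  note prime_pi = \<pi>(1)[unfolded mod_prime_def, THEN conjunct2, THEN conjunct2, rule_format]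
  define U where "U = [:1, 0, 1 :: int:]"
  define V where "V = [:1, 0, -1 :: int:]"
  have "mod_dvd (int p) \<pi> ([:0, 1:] * pderiv (fpoly n a))"
    by (intro mod_dvd_mult mod_dvd_pderiv \<pi>)
  then have "mod_dvd (int p) \<pi> (fpoly n a - U ^ (n - 1) * V)"
    unfolding pderiv_fpoly[OF n0] U_def V_def
    using mod_dvd_smult_cancel[OF prime_p, of "int n"] assms(2) by simp
  from mod_dvd_diff[OF \<pi>(3) this] have "mod_dvd (int p) \<pi> (U ^ (n - 1) * V)" by simp
  then have "mod_dvd (int p) \<pi> U \<or> mod_dvd (int p) \<pi> V"
    using prime_pi mod_prime_power[OF p1 \<pi>(1)] by blast
  moreover have "\<not> mod_dvd (int p) \<pi> U"
  proof
    assume U: "mod_dvd (int p) \<pi> U"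
    have "U ^ n = U ^ (n - 1) * U" by (rule power_minus_mult[OF n0, symmetric])
    then have "mod_dvd (int p) \<pi> (U ^ n)" using mod_dvd_mult[OF U] by simp
    from mod_dvd_diff[OF this \<pi>(3)] have "mod_dvd (int p) \<pi> (smult a ([:0, 1:] ^ n))"
      by (simp add: fpoly_X U_def)
    then show False using X_power_coeff[OF \<pi>(1,3)] assms(1) by blast
  qed
  ultimately have "mod_dvd (int p) \<pi> (- V)" using mod_dvd_minus by blast
  also have "- V = [:- 1, 1:] * [:- (- 1), 1:]"
    by (intro iffD1[OF poly_eq_poly_eq_iff] ext) (simp add: V_def algebra_simps)
  finally have "mod_dvd (int p) \<pi> [:- 1, 1:] \<or> mod_dvd (int p) \<pi> [:- (- 1), 1:]"
    using prime_pi by blast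
  then have "(int p)\<^sup>2 dvd poly (fpoly n a) 1 \<or> (int p)\<^sup>2 dvd poly (fpoly n a) (- 1)"
    using mod_sq_linear_root[OF p1 \<pi>(1) _ \<pi>(2)] by blast
  then show ?thesis by (simp add: poly_fpoly mult.commute)
qed

text \<open>Taylor expansion at \<open>e\<close>: \<open>f = (x-e)^2 s + (x-e) f'(e) + f(e)\<close>.
  As \<open>e^2 = 1\<close> kills the last term of \<open>pderiv_fpoly\<close>,
  \<open>e f'(e) = n f(e)\<close>, so the linear coefficient is divisible by \<open>p\<close>
  whenever \<open>f(e)\<close> is divisible by \<open>p^2\<close>.\<close>

lemma root_imp_index:
  assumes e: "e\<^sup>2 = 1" and dvd: "(int p)\<^sup>2 dvd poly (fpoly n a) e"
  shows "p dvd order_index \<theta>"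
proof -
  define f where "f = fpoly n a"
  define \<pi> where "\<pi> = [:- e, 1:]"
  have lin: "\<exists>g. h = \<pi> * g + [:poly h e:]" for h
  proof -
    have "\<pi> dvd h - [:poly h e:]" unfolding \<pi>_def
      by (rule poly_eq_0_iff_dvd[THEN iffD1]) simp
    then obtain g where "h - [:poly h e:] = \<pi> * g" ..
    then show ?thesis by (metis diff_add_cancel)
  qed
  obtain g where g: "f = \<pi> * g + [:poly f e:]" using lin by blast
  obtain s where s: "g = \<pi> * s + [:poly g e:]" using lin by blast
  have "poly (pderiv f) e = poly g e"
    using arg_cong[OF g, of "\<lambda>h. poly (pderiv h) e"]
    by (simp add: pderiv_add pderiv_mult \<pi>_def pderiv_pCons del: mult_pCons_left)
  moreover have "e * poly (pderiv f) e = int n * poly f e"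
    using arg_cong[OF pderiv_fpoly[OF n0, of a], of "\<lambda>h. poly h e"] e
    by (simp add: f_def power2_eq_square)
  ultimately have "e * (e * poly g e) = e * (int n * poly f e)" by simp
  then have "poly g e = e * (int n * poly f e)" 
    using e by (metis mult.assoc mult_1_left power2_eq_square)
  then have "(int p)\<^sup>2 dvd poly g e" using dvd by (simp add: f_def)
  then have "int p dvd poly g e" by (metis dvd_mult_left power2_eq_square)
  then obtain t where t: "poly g e = int p * t" by (rule dvdE)
  obtain u where u: "poly f e = (int p)\<^sup>2 * u" using dvd unfolding f_def by (rule dvdE)
  have "\<pi> * g = \<pi> * (\<pi> * s) + \<pi> * [:poly g e:]" by (subst s) (simp only: distrib_left)
  then have "f = \<pi> * (\<pi> * s) + \<pi> * [:poly g e:] + [:poly f e:]" using g by simp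
  also have "\<dots> = \<pi>\<^sup>2 * s + smult (int p) (\<pi> * [:t:]) + smult ((int p)\<^sup>2) [:u:]"
    unfolding t u by (simp add: power2_eq_square mult.assoc del: mult_pCons_left)
  finally have f: "f = \<pi>\<^sup>2 * s + smult (int p) (\<pi> * [:t:]) + smult ((int p)\<^sup>2) [:u:]" .
  have F: "degree f = 2 * n" "lead_coeff f = 1" using fpoly_monic[OF n0] by (auto simp: f_def)
  have \<pi>: "degree \<pi> = 1" "lead_coeff \<pi> = 1" "\<pi> \<noteq> 0" by (simp_all add: \<pi>_def)
  have step: "degree k + 1 = degree h \<and> lead_coeff k = 1"
    if h: "h = \<pi> * k + [:c:]" "lead_coeff h = 1" "degree h > 0" for h k c
  proof -
    have "k \<noteq> 0" using h by auto
    then have dk: "degree (\<pi> * k) = 1 + degree k" using \<pi> by (simp add: degree_mult_eq)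
    then have lt: "degree [:c:] < degree (\<pi> * k)" by simp
    have "degree h = degree (\<pi> * k)" unfolding h(1) by (rule degree_add_eq_left[OF lt])
    moreover have "lead_coeff h = lead_coeff (\<pi> * k)"
      unfolding h(1) using lead_coeff_add_le[OF lt] by (simp only: add.commute)
    ultimately have "degree h = 1 + degree k" "lead_coeff (\<pi> * k) = 1"
      using h(2) dk by metis+
    then show ?thesis using \<pi>(2) lead_coeff_mult[of \<pi> k] by simp
  qed
  have G: "degree g = 2 * n - 1" "lead_coeff g = 1" using step[OF g] F n0 by auto
  then have "degree s = 2 * n - 2" "lead_coeff s = 1" using step[OF s] n2 by auto
  then have "degree (\<pi> * s) = 2 * n - 1" "lead_coeff (\<pi> * s) = 1"
  proof -
    have "s \<noteq> 0" using \<open>lead_coeff s = 1\<close> by auto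
    then have "degree (\<pi> * s) = degree \<pi> + degree s" using \<pi>(3) degree_mult_eq by blast
    then show "degree (\<pi> * s) = 2 * n - 1" using \<pi>(1) \<open>degree s = 2 * n - 2\<close> n2 by simp
    show "lead_coeff (\<pi> * s) = 1"
      using \<pi>(2) \<open>lead_coeff s = 1\<close> lead_coeff_mult[of \<pi> s] by simp
  qed
  then show ?thesis
    using prime_dvd_index[OF p f[unfolded f_def]] n2 fpoly_monic(1)[OF n0, of a] by simp
qed

end

theorem theorem1p2:
  fixes n :: nat and a :: int and p :: nat and \<theta> :: complex
  assumes n2: "n \<ge> 2"
    and irr: "irreducible (map_poly (of_int :: int \<Rightarrow> rat) (fpoly n a))"
    and root: "poly (map_poly of_int (fpoly n a)) \<theta> = 0"
    and pp: "prime p"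
    and pdisc: "int p dvd poly_disc (fpoly n a)"
  shows "\<not> p dvd order_index \<theta> \<longleftrightarrow>
    (if int p dvd a then \<not> (int p)^2 dvd a
     else if p dvd n then \<not> (int p)^2 dvd (a ^ (p ^ multiplicity p n) - a)
     else if odd n then \<not> (int p)^2 dvd poly_disc (fpoly n a)
     else \<not> (int p)^2 dvd (2 ^ n - a))"
proof -
  interpret fpoly_root n a \<theta> p
    using n2 fpoly_monic(2)[of n a] irr root pp by unfold_locales (auto simp: ipoly_def)
  have one: "p dvd order_index \<theta>" if "(int p)\<^sup>2 dvd 2 ^ n - a"
    using root_imp_index[of 1] that by (simp add: poly_fpoly)
  have minus: "p dvd order_index \<theta>" if "(int p)\<^sup>2 dvd 2 ^ n - (- 1) ^ n * a"
    using root_imp_index[of "- 1"] that by (simp add: poly_fpoly mult.commute)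
  show ?thesis
  proof (cases "int p dvd a \<or> p dvd n")
    case True
    then show ?thesis using index_iff_dvd_a index_iff_dvd_n by auto
  next
    case False
    then have na: "\<not> int p dvd a" and nn: "\<not> p dvd n" by auto
    have iff: "p dvd order_index \<theta> \<longleftrightarrow>
        (int p)\<^sup>2 dvd 2 ^ n - a \<or> (int p)\<^sup>2 dvd 2 ^ n - (- 1) ^ n * a"
      using index_imp_root[OF na nn] one minus by blast
    show ?thesis
    proof (cases "odd n")
      case False
      then show ?thesis using na nn iff by simp
    next
      case True
      define D where "D = (2 ^ n - a) * (2 ^ n + a)"
      have res: "resultant (fpoly n a) (pderiv (fpoly n a)) = int n ^ (2 * n) * (a\<^sup>2) ^ (n - 1) * D"
        using resultant_fpoly[OF n0, of a] True by (simp add: D_def)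
      have "(int p)\<^sup>2 dvd poly_disc (fpoly n a) \<longleftrightarrow> (int p)\<^sup>2 dvd int n ^ (2 * n) * (a\<^sup>2) ^ (n - 1) * D"
        unfolding poly_disc_def res fpoly_monic(2)[OF n0] by (simp add: minus_one_power_iff)
      also have "\<dots> \<longleftrightarrow> (int p)\<^sup>2 dvd D"
      proof -
        have "coprime (int p) (int n)" "coprime (int p) a"
          using prime_p na nn by (auto intro!: prime_imp_coprime)
        then have "coprime ((int p)\<^sup>2) (int n ^ (2 * n) * (a\<^sup>2) ^ (n - 1))" by simp
        then show ?thesis by (rule coprime_dvd_mult_right_iff)
      qed
      also have "\<dots> \<longleftrightarrow> (int p)\<^sup>2 dvd 2 ^ n - a \<or> (int p)\<^sup>2 dvd 2 ^ n + a"
      proof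
        assume D: "(int p)\<^sup>2 dvd D"
        \<comment> \<open>A common prime factor would divide the sum \<open>2^(n+1)\<close>, hence
          2, hence \<open>a\<close>. So \<open>p^2\<close> is coprime to one factor and passes
          undivided to the other.\<close>
        have "\<not> (int p dvd 2 ^ n - a \<and> int p dvd 2 ^ n + a)"
        proof
          assume *: "int p dvd 2 ^ n - a \<and> int p dvd 2 ^ n + a"
          then have "int p dvd (2 ^ n + a) + (2 ^ n - a)" using dvd_add by blast
          then have "int p dvd 2 ^ Suc n" by simp
          then have "int p dvd 2" using prime_dvd_power[OF prime_p] by blast
          then have "int p dvd 2 ^ n" using n0 by (meson dvd_power dvd_trans)
          then have "int p dvd (2 ^ n + a) - 2 ^ n" using * dvd_diff by blast
          with na show False by simp
        qed
        then have "coprime ((int p)\<^sup>2) (2 ^ n - a) \<or> coprime ((int p)\<^sup>2) (2 ^ n + a)"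
          using prime_p by (auto intro!: prime_imp_coprime)
        with D show "(int p)\<^sup>2 dvd 2 ^ n - a \<or> (int p)\<^sup>2 dvd 2 ^ n + a"
          unfolding D_def by (auto simp: coprime_dvd_mult_left_iff coprime_dvd_mult_right_iff)
      qed (auto simp: D_def)
      finally show ?thesis using na nn iff True by simp
    qed
  qed
qed

end
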